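(* Let $X$ be a Banach space, $Y\subseteq X$ a closed subspace, and $Q:X\to X/Y$ the quotient map. Let $\alpha$ be an isometric automorphism of $X$ such that $\alpha(Y)=Y$, and denote by $\bar\alpha$ the induced isometric automorphism of $X/Y$ (so $\bar\alpha\circ Q=Q\circ\alpha$). Then $\mathrm{hc}(\alpha)=0$ if and only if $\mathrm{hc}(\alpha|_Y)=\mathrm{hc}(\bar\alpha)=0$.
   Context: All Banach spaces are over $\mathbb{C}$. CA entropy: For a bounded linear map $\gamma:X\to Y$ of Banach spaces, a finite set $\Omega\subseteq X$ and $\delta>0$, let $\mathrm{CA}(\gamma,\Omega,\delta)$ be the collection of triples $(\phi,\psi,d)$ where $d$ is a positive integer and $\phi:X\to\ell_\infty^d$, $\psi:\ell_\infty^d\to Y$ are contractive (norm $\le1$) linear maps with $\|\psi\circ\phi(x)-\gamma(x)\|<\delta$ for all $x\in\Omega$. A CA embedding of $X$ is an isometric linear map $\iota$ from $X$ into a Banach space $Y$ such that $\mathrm{CA}(\iota,\Omega,\delta)\neq\emptyset$ for all finite $\Omega\subseteq X$ and $\delta>0$; every Banach space has one (e.g. the evaluation map $X\to C(B_1(X^* ))$, where $B_1(X^* )$ is the weak$^*$ compact unit ball of the dual). Set $\mathrm{rc}(\Omega,\delta)=\inf\{d:(\phi,\psi,d)\in\mathrm{CA}(\iota,\Omega,\delta)\}$, which does not depend on the CA embedding $\iota$. For an isometric (surjective linear) automorphism $\alpha$ of $X$ put $\mathrm{hc}(\alpha,\Omega,\delta)=\limsup_{n\to\infty}\frac1n\log\mathrm{rc}(\Omega\cup\alpha\Omega\cup\cdots\cup\alpha^{n-1}\Omega,\delta)$,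 $\mathrm{hc}(\alpha,\Omega)=\sup_{\delta>0}\mathrm{hc}(\alpha,\Omega,\delta)$, and $\mathrm{hc}(\alpha)=\sup_\Omega\mathrm{hc}(\alpha,\Omega)$ over finite $\Omega\subseteq X$. *)

theory Defs
  imports "HOL-Analysis.Analysis" "HOL-Algebra.Module" "HOL-Algebra.AbelCoset"
begin

section \<open>Complex normed spaces and Banach spaces\<close>

text \<open>
  Subspaces and quotients of a Banach space have to be Banach spaces again, so a normed space is a
  record with an explicit carrier set: a module over the field of complex numbers together with a
  norm.  The fields \<open>mult\<close> and \<open>one\<close>, inherited from the record of rings, are
  never used.
\<close>

record 'a normed_space = "(complex, 'a) module" +
  nrm :: "'a \<Rightarrow> real"

definition complex_field :: "complex ring" where
  "complex_field =
     \<lparr>carrier = UNIV, monoid.mult = (*), one = 1, ring.zero = 0, add = (+)\<rparr>"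

locale complex_normed_space = module complex_field X
  for X :: "'a normed_space" (structure) +
  assumes nrm_eq_0_iff: "x \<in> carrier X \<Longrightarrow> nrm X x = 0 \<longleftrightarrow> x = \<zero>"
    and nrm_triangle:
      "x \<in> carrier X \<Longrightarrow> y \<in> carrier X \<Longrightarrow> nrm X (x \<oplus> y) \<le> nrm X x + nrm X y"
    and nrm_smult: "x \<in> carrier X \<Longrightarrow> nrm X (c \<odot>\<^bsub>X\<^esub> x) = cmod c * nrm X x"

text \<open>
  The locale \<^locale>\<open>Metric_space\<close> requires a distance that is symmetric and nonnegative
  on the whole type; hence the value 0 off the carrier.
\<close>

definition nrm_dist :: "'a normed_space \<Rightarrow> 'a \<Rightarrow> 'a \<Rightarrow> real" where
  "nrm_dist X x y =
     (if x \<in> carrier X \<and> y \<in> carrier X then nrm X (x \<ominus>\<^bsub>X\<^esub> y) else 0)"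

definition nrm_topology :: "'a normed_space \<Rightarrow> 'a topology" where
  "nrm_topology X = Metric_space.mtopology (carrier X) (nrm_dist X)"

definition banach_space :: "'a normed_space \<Rightarrow> bool" where
  "banach_space X \<longleftrightarrow>
     complex_normed_space X \<and> Metric_space.mcomplete (carrier X) (nrm_dist X)"

definition closed_subspace :: "'a set \<Rightarrow> 'a normed_space \<Rightarrow> bool" where
  "closed_subspace Y X \<longleftrightarrow> submodule Y complex_field X \<and> closedin (nrm_topology X) Y"

definition subspace_of :: "'a normed_space \<Rightarrow> 'a set \<Rightarrow> 'a normed_space" where
  "subspace_of X Y = X\<lparr>carrier := Y\<rparr>"

text \<open>
  The elements of the quotient are the cosets \<open>Y + x\<close>; the norm of a coset is the infimum
  of the norms of its elements.  The union in the scalar multiple has all its terms equal; the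
  pointwise product with the scalar would not do, since for the scalar 0 it is not a coset.
\<close>

definition quotient_space :: "'a normed_space \<Rightarrow> 'a set \<Rightarrow> 'a set normed_space" where
  "quotient_space X Y =
     \<lparr>carrier = a_rcosets\<^bsub>X\<^esub> Y,
      monoid.mult = (\<lambda>_ _. undefined),
      one = undefined,
      ring.zero = Y,
      add = (\<lambda>A B. A <+>\<^bsub>X\<^esub> B),
      smult = (\<lambda>c A. \<Union>x\<in>A. Y +>\<^bsub>X\<^esub> (c \<odot>\<^bsub>X\<^esub> x)),
      nrm = (\<lambda>A. INF x\<in>A. nrm X x)\<rparr>"

definition quotient_proj :: "'a normed_space \<Rightarrow> 'a set \<Rightarrow> 'a \<Rightarrow> 'a set" where
  "quotient_proj X Y x = Y +>\<^bsub>X\<^esub> x"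

text \<open>
  The space of \<open>d\<close>-tuples with the maximum norm, for \<open>d > 0\<close>; a tuple is a sequence
  that vanishes from index \<open>d\<close> on.
\<close>

definition linf :: "nat \<Rightarrow> (nat \<Rightarrow> complex) normed_space" where
  "linf d =
     \<lparr>carrier = {v. \<forall>i\<ge>d. v i = 0},
      monoid.mult = (\<lambda>_ _. undefined),
      one = undefined,
      ring.zero = (\<lambda>i. 0),
      add = (\<lambda>v w i. v i + w i),
      smult = (\<lambda>c v i. c * v i),
      nrm = (\<lambda>v. MAX i\<in>{..<d}. cmod (v i))\<rparr>"


section \<open>Linear maps\<close>

definition linear_map :: "'a normed_space \<Rightarrow> 'b normed_space \<Rightarrow> ('a \<Rightarrow> 'b) \<Rightarrow> bool" where
  "linear_map X Y f \<longleftrightarrow>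
     f \<in> carrier X \<rightarrow> carrier Y \<and>
     (\<forall>x\<in>carrier X. \<forall>y\<in>carrier X. f (x \<oplus>\<^bsub>X\<^esub> y) = f x \<oplus>\<^bsub>Y\<^esub> f y) \<and>
     (\<forall>c. \<forall>x\<in>carrier X. f (c \<odot>\<^bsub>X\<^esub> x) = c \<odot>\<^bsub>Y\<^esub> f x)"

definition contractive_map :: "'a normed_space \<Rightarrow> 'b normed_space \<Rightarrow> ('a \<Rightarrow> 'b) \<Rightarrow> bool" where
  "contractive_map X Y f \<longleftrightarrow> linear_map X Y f \<and> (\<forall>x\<in>carrier X. nrm Y (f x) \<le> nrm X x)"

definition isometric_map :: "'a normed_space \<Rightarrow> 'b normed_space \<Rightarrow> ('a \<Rightarrow> 'b) \<Rightarrow> bool" where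
  "isometric_map X Y f \<longleftrightarrow> linear_map X Y f \<and> (\<forall>x\<in>carrier X. nrm Y (f x) = nrm X x)"

definition isometric_automorphism :: "'a normed_space \<Rightarrow> ('a \<Rightarrow> 'a) \<Rightarrow> bool" where
  "isometric_automorphism X \<alpha> \<longleftrightarrow> isometric_map X X \<alpha> \<and> \<alpha> ` carrier X = carrier X"


section \<open>Contractive approximation entropy\<close>

definition CA ::
  "'a normed_space \<Rightarrow> 'b normed_space \<Rightarrow> ('a \<Rightarrow> 'b) \<Rightarrow> 'a set \<Rightarrow> real \<Rightarrow>
    (('a \<Rightarrow> nat \<Rightarrow> complex) \<times> ((nat \<Rightarrow> complex) \<Rightarrow> 'b) \<times> nat) set" where
  "CA X Y \<gamma> \<Omega> \<delta> =
     {(\<phi>, \<psi>, d). d > 0 \<and> contractive_map X (linf d) \<phi> \<and> contractive_map (linf d) Y \<psi> \<and>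
        (\<forall>x\<in>\<Omega>. nrm Y (\<psi> (\<phi> x) \<ominus>\<^bsub>Y\<^esub> \<gamma> x) < \<delta>)}"

definition CA_embedding :: "'a normed_space \<Rightarrow> 'b normed_space \<Rightarrow> ('a \<Rightarrow> 'b) \<Rightarrow> bool" where
  "CA_embedding X E \<iota> \<longleftrightarrow>
     banach_space E \<and> isometric_map X E \<iota> \<and>
     (\<forall>\<Omega> \<delta>. finite \<Omega> \<and> \<Omega> \<subseteq> carrier X \<and> \<delta> > 0 \<longrightarrow> CA X E \<iota> \<Omega> \<delta> \<noteq> {})"

text \<open>
  The numbers \<open>rc\<close> and \<open>hc\<close> carry the embedding \<open>\<iota> : X \<rightarrow> E\<close> as a parameter.
  They are used only for CA embeddings; the infimum in \<open>rc\<close> is then over a nonempty set, and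
  its value is the same for all CA embeddings of \<open>X\<close>.
\<close>

definition rc :: "'a normed_space \<Rightarrow> 'b normed_space \<Rightarrow> ('a \<Rightarrow> 'b) \<Rightarrow> 'a set \<Rightarrow> real \<Rightarrow> nat" where
  "rc X E \<iota> \<Omega> \<delta> = Inf {d. \<exists>\<phi> \<psi>. (\<phi>, \<psi>, d) \<in> CA X E \<iota> \<Omega> \<delta>}"

definition hc_scale ::
  "'a normed_space \<Rightarrow> 'b normed_space \<Rightarrow> ('a \<Rightarrow> 'b) \<Rightarrow> ('a \<Rightarrow> 'a) \<Rightarrow> 'a set \<Rightarrow> real \<Rightarrow> ereal" where
  "hc_scale X E \<iota> \<alpha> \<Omega> \<delta> =
     limsup (\<lambda>n. ereal (1 / real n * ln (real (rc X E \<iota> (\<Union>k<n. (\<alpha> ^^ k) ` \<Omega>) \<delta>))))"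

definition hc_set ::
  "'a normed_space \<Rightarrow> 'b normed_space \<Rightarrow> ('a \<Rightarrow> 'b) \<Rightarrow> ('a \<Rightarrow> 'a) \<Rightarrow> 'a set \<Rightarrow> ereal" where
  "hc_set X E \<iota> \<alpha> \<Omega> = (SUP \<delta>\<in>{0<..}. hc_scale X E \<iota> \<alpha> \<Omega> \<delta>)"

definition hc ::
  "'a normed_space \<Rightarrow> 'b normed_space \<Rightarrow> ('a \<Rightarrow> 'b) \<Rightarrow> ('a \<Rightarrow> 'a) \<Rightarrow> ereal" where
  "hc X E \<iota> \<alpha> = (SUP \<Omega>\<in>{\<Omega>. finite \<Omega> \<and> \<Omega> \<subseteq> carrier X}. hc_set X E \<iota> \<alpha> \<Omega>)"

end

theory Submission
  imports Defs
begin

text \<open>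
  The idea is to read off \<open>hc(\<alpha>) = 0\<close> from the dual unit ball.  Say that a set of functionals is
  covered at scale \<open>\<epsilon>\<close> on a finite set \<open>P\<close> by \<open>N\<close> labels if functionals with
  equal labels differ by at most \<open>\<epsilon>\<close> on \<open>P\<close>.  Then \<open>hc(\<alpha>) = 0\<close> holds if and only if,
  at every scale and for every finite \<open>\<Omega>\<close>, the dual unit ball is covered on
  \<open>\<Omega> \<union> \<dots> \<union> \<alpha>\<^sup>n\<^sup>-\<^sup>1\<Omega>\<close> by subexponentially many labels.

  That coverings give factorizations (\<open>CA_of_sup_coverable\<close>) is easy: in a factorization of the CA
  embedding through a space of tuples of any length, the coordinates are functionals in the dual ball, and
  coordinates with the same label may be replaced by a single one.

  The converse (\<open>dual_ball_sup_coverable\<close>) is the heart of the matter.  A factorization through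
  \<open>d\<close>-tuples says, by duality, that on \<open>P\<close> every functional of norm at most 1 lies near the
  absolutely convex hull of the \<open>d\<close> coordinate functionals.  A greedy approximation
  (\<open>greedy_average\<close>) brings it within a prescribed error of an average of \<open>m\<close> of them, up
  to phases, where \<open>m\<close> depends on the error alone; the error is measured in mean square over
  \<open>P\<close>, which is what makes \<open>m\<close> independent of the size of \<open>P\<close>.  There are at most
  \<open>(4d)\<^sup>m\<close> such averages, a subexponential number if \<open>d\<close> is.  A small mean square
  error is a small error off a small proportion of the points, and recording the values at the exceptional
  points costs a factor \<open>exp(\<theta> |P|)\<close> with \<open>\<theta>\<close> as small as desired
  (\<open>sup_coverable_of_dual_bound\<close>).

  In this form the theorem resembles Bowen's inequality for the entropy of an extension.  Factorizations
  restrict to subspaces, and coverings of the dual ball pass to quotients, because composition with the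
  quotient map sends functionals on \<open>X/Y\<close> to functionals on \<open>X\<close>.  For the other direction
  (\<open>coverable_extension\<close>), cover the dual ball of \<open>Y\<close> first.  The difference of two
  functionals on \<open>X\<close> whose restrictions to \<open>Y\<close> have the same label is small on a finite
  subset of \<open>Y\<close>, and at all times at which the orbit is observed.  By compactness of the set of
  normalized coefficients this makes it, on a fixed finite subset of \<open>X\<close>, almost a functional on
  \<open>X/Y\<close> (\<open>small_on_Y_almost_annihilates\<close>).  So over a block of \<open>M\<close> consecutive times
  there are at most \<open>exp(\<theta>M)\<close> labels for it, where the block length \<open>M\<close> is chosen once
  for all functionals, and the labels for about \<open>n/M\<close> blocks multiply to about
  \<open>exp(\<theta>n)\<close>.
\<close>

section \<open>Sparse approximation and coverings over a finite set\<close>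

text \<open>
  The hypothesis says that no functional \<open>a\<close> separates \<open>b\<close> from all the atoms \<open>B j\<close> by
  more than \<open>\<delta>\<close> times its \<open>\<ell>\<^sub>1\<close> norm.  Adding the atom obtained for the conjugate of the
  current error makes the inner product of the error with its increment almost nonpositive.  So the squares of
  the increments add up, as they do for orthogonal increments, and the error of the sum of \<open>m\<close> atoms
  grows only like the square root of \<open>m\<close>, apart from the contribution of \<open>\<delta>\<close>.
\<close>

lemma greedy_average:
  fixes b :: "'a \<Rightarrow> complex" and B :: "'j \<Rightarrow> 'a \<Rightarrow> complex" and R \<delta> :: real
  assumes fin: "finite P" and R: "R \<ge> 0" and \<delta>: "\<delta> \<ge> 0"
    and b: "\<And>p. p \<in> P \<Longrightarrow> cmod (b p) \<le> R"
    and B: "\<And>j p. j \<in> J \<Longrightarrow> p \<in> P \<Longrightarrow> cmod (B j p) \<le> R"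
    and dual: "\<And>a. \<exists>j\<in>J. Re (\<Sum>p\<in>P. a p * b p) \<le> Re (\<Sum>p\<in>P. a p * B j p) + \<delta> * (\<Sum>p\<in>P. cmod (a p))"
  shows "\<exists>js. length js = m \<and> set js \<subseteq> J \<and>
    (\<Sum>p\<in>P. (cmod (of_nat m * b p - (\<Sum>j\<leftarrow>js. B j p)))\<^sup>2)
      \<le> card P * (4 * R\<^sup>2 * m + 4 * R * \<delta> * (real m)\<^sup>2)"
proof (induction m)
  case 0
  show ?case by simp
next
  case (Suc m)
  then obtain js where len: "length js = m" and js: "set js \<subseteq> J"
    and err: "(\<Sum>p\<in>P. (cmod (of_nat m * b p - (\<Sum>j\<leftarrow>js. B j p)))\<^sup>2)
      \<le> card P * (4 * R\<^sup>2 * m + 4 * R * \<delta> * (real m)\<^sup>2)" by blast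
  define D where "D p = of_nat m * b p - (\<Sum>j\<leftarrow>js. B j p)" for p
  obtain j where j: "j \<in> J" and
    pick: "Re (\<Sum>p\<in>P. cnj (D p) * b p)
      \<le> Re (\<Sum>p\<in>P. cnj (D p) * B j p) + \<delta> * (\<Sum>p\<in>P. cmod (cnj (D p)))"
    using dual[of "\<lambda>p. cnj (D p)"] by blast
  have sum_bound: "cmod (\<Sum>j\<leftarrow>ks. B j p) \<le> length ks * R" if "set ks \<subseteq> J" "p \<in> P" for ks p
    using that
  proof (induction ks)
    case (Cons k ks)
    have "cmod (B k p + (\<Sum>j\<leftarrow>ks. B j p)) \<le> R + length ks * R"
      using Cons B[of k p] by (intro order_trans[OF norm_triangle_ineq] add_mono) auto
    then show ?case by (simp add: algebra_simps)
  qed simp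
  have D_bound: "cmod (D p) \<le> 2 * R * m" if "p \<in> P" for p
  proof -
    have "cmod (D p) \<le> cmod (of_nat m * b p) + cmod (\<Sum>j\<leftarrow>js. B j p)"
      unfolding D_def by (rule norm_triangle_ineq4)
    also have "\<dots> \<le> m * R + m * R"
      using b[OF that] sum_bound[OF js that] len
      by (intro add_mono) (auto simp: norm_mult intro: mult_left_mono)
    finally show ?thesis by simp
  qed
  have D_sum: "(\<Sum>p\<in>P. cmod (D p)) \<le> card P * (2 * R * m)"
    using sum_bounded_above[of P "\<lambda>p. cmod (D p)" "2 * R * m"] D_bound by simp
  have expand: "(cmod (D p + (b p - B j p)))\<^sup>2
      = (cmod (D p))\<^sup>2 + 2 * (Re (cnj (D p) * b p) - Re (cnj (D p) * B j p)) + (cmod (b p - B j p))\<^sup>2" for p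
    unfolding cmod_power2 by (simp add: power2_eq_square algebra_simps)
  have step: "(cmod (b p - B j p))\<^sup>2 \<le> 4 * R\<^sup>2" if "p \<in> P" for p
  proof -
    have "cmod (b p - B j p) \<le> 2 * R"
      using norm_triangle_ineq4[of "b p" "B j p"] b[OF that] B[OF j that] by linarith
    then have "(cmod (b p - B j p))\<^sup>2 \<le> (2 * R)\<^sup>2"
      by (intro power_mono) auto
    then show ?thesis by (simp add: power2_eq_square)
  qed
  have "(\<Sum>p\<in>P. (cmod (D p + (b p - B j p)))\<^sup>2)
      = (\<Sum>p\<in>P. (cmod (D p))\<^sup>2) + 2 * (Re (\<Sum>p\<in>P. cnj (D p) * b p) - Re (\<Sum>p\<in>P. cnj (D p) * B j p))
        + (\<Sum>p\<in>P. (cmod (b p - B j p))\<^sup>2)"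
    unfolding expand by (simp only: sum.distrib sum_distrib_left[symmetric] sum_subtractf Re_sum)
  also have "\<dots> \<le> card P * (4 * R\<^sup>2 * m + 4 * R * \<delta> * (real m)\<^sup>2) + 2 * (\<delta> * (card P * (2 * R * m)))
        + card P * (4 * R\<^sup>2)"
  proof (intro add_mono mult_left_mono)
    show "(\<Sum>p\<in>P. (cmod (D p))\<^sup>2) \<le> card P * (4 * R\<^sup>2 * m + 4 * R * \<delta> * (real m)\<^sup>2)"
      using err unfolding D_def .
    show "Re (\<Sum>p\<in>P. cnj (D p) * b p) - Re (\<Sum>p\<in>P. cnj (D p) * B j p) \<le> \<delta> * (card P * (2 * R * m))"
      using pick mult_left_mono[OF D_sum \<delta>] by simp
    show "(\<Sum>p\<in>P. (cmod (b p - B j p))\<^sup>2) \<le> card P * (4 * R\<^sup>2)"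
      using sum_bounded_above[of P "\<lambda>p. (cmod (b p - B j p))\<^sup>2" "4 * R\<^sup>2"] step by simp
  qed simp
  also have "\<dots> \<le> card P * (4 * R\<^sup>2 * Suc m + 4 * R * \<delta> * (real (Suc m))\<^sup>2)"
  proof -
    have "0 \<le> card P * (4 * R * \<delta> * (m + 1))" using R \<delta> by simp
    then show ?thesis by (simp add: power2_eq_square algebra_simps)
  qed
  finally have "(\<Sum>p\<in>P. (cmod (of_nat (Suc m) * b p - (\<Sum>j\<leftarrow>j # js. B j p)))\<^sup>2)
      \<le> card P * (4 * R\<^sup>2 * Suc m + 4 * R * \<delta> * (real (Suc m))\<^sup>2)"
    unfolding D_def by (simp add: algebra_simps)
  then show ?case
    using len js j by (intro exI[of _ "j # js"]) auto
qed

text \<open>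
  Give a function the weight \<open>\<kappa>\<close> for each of its nonzero values.  The total weight of all
  functions is a product over the points of \<open>P\<close>, while each function counted has weight at least
  \<open>\<kappa> powr s\<close>.
\<close>

lemma card_PiE_few_nonzero:
  fixes s \<kappa> :: real
  assumes fin: "finite P" and \<kappa>: "0 < \<kappa>" "\<kappa> \<le> 1"
  shows "card {h \<in> P \<rightarrow>\<^sub>E {..q::nat}. card {p\<in>P. h p \<noteq> 0} \<le> s} \<le> (1 + \<kappa> * q) ^ card P * \<kappa> powr (- s)"
proof -
  let ?H = "{h \<in> P \<rightarrow>\<^sub>E {..q}. card {p\<in>P. h p \<noteq> 0} \<le> s}"
  define w where "w v = (if v = 0 then 1 else \<kappa>)" for v :: nat
  have finE: "finite (P \<rightarrow>\<^sub>E {..q})" by (intro finite_PiE fin) auto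
  have w: "(\<Prod>p\<in>P. w (h p)) = \<kappa> ^ card {p\<in>P. h p \<noteq> 0}" for h
  proof -
    have "(\<Prod>p\<in>P. w (h p)) = (\<Prod>p\<in>{p\<in>P. h p \<noteq> 0}. \<kappa>)"
      unfolding w_def by (rule prod.mono_neutral_cong_right) (use fin in auto)
    then show ?thesis by simp
  qed
  have "card ?H * \<kappa> powr s = (\<Sum>h\<in>?H. \<kappa> powr s)" by simp
  also have "\<dots> \<le> (\<Sum>h\<in>?H. \<Prod>p\<in>P. w (h p))"
  proof (rule sum_mono)
    fix h assume "h \<in> ?H"
    then have "\<kappa> powr s \<le> \<kappa> powr card {p\<in>P. h p \<noteq> 0}"
      using \<kappa> by (intro powr_mono') auto
    then show "\<kappa> powr s \<le> (\<Prod>p\<in>P. w (h p))"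
      using \<kappa> by (simp add: w powr_realpow)
  qed
  also have "\<dots> \<le> (\<Sum>h\<in>P \<rightarrow>\<^sub>E {..q}. \<Prod>p\<in>P. w (h p))"
    by (rule sum_mono2[OF finE]) (use \<kappa> in \<open>auto simp: w_def intro!: prod_nonneg\<close>)
  also have "\<dots> = (\<Prod>p\<in>P. \<Sum>v\<le>q. w v)"
    by (rule prod_sum_PiE[symmetric]) (use fin in auto)
  also have "(\<Sum>v\<le>q. w v) = 1 + \<kappa> * q"
    by (cases q) (simp_all add: w_def sum.atMost_Suc_shift del: sum.atMost_Suc)
  finally have "card ?H * \<kappa> powr s \<le> (1 + \<kappa> * q) ^ card P" by simp
  then show ?thesis
    using \<kappa> by (simp add: powr_minus field_simps)
qed

lemma bounded_separating_labels:
  fixes \<epsilon> R :: real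
  assumes "\<epsilon> > 0"
  obtains q :: nat and r :: "complex \<Rightarrow> nat"
  where "\<And>v. cmod v \<le> R \<Longrightarrow> r v < q"
    and "\<And>v w. cmod v \<le> R \<Longrightarrow> cmod w \<le> R \<Longrightarrow> r v = r w \<Longrightarrow> cmod (v - w) \<le> \<epsilon>"
proof -
  have "\<exists>K. finite K \<and> cball (0::complex) R \<subseteq> (\<Union>x\<in>K. ball x (\<epsilon>/2))"
    using compact_cball[of "0::complex" R] assms unfolding compact_eq_totally_bounded
    by (meson half_gt_zero)
  then obtain K where K: "finite K" "cball (0::complex) R \<subseteq> (\<Union>x\<in>K. ball x (\<epsilon>/2))" by blast
  obtain e and q :: nat where e: "bij_betw e K {..<q}"
    using ex_bij_betw_finite_nat[OF K(1)] by (auto simp: atLeast0LessThan)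
  define c where "c v = (SOME x. x \<in> K \<and> v \<in> ball x (\<epsilon>/2))" for v
  have c: "c v \<in> K \<and> v \<in> ball (c v) (\<epsilon>/2)" if "cmod v \<le> R" for v
  proof -
    have "v \<in> (\<Union>x\<in>K. ball x (\<epsilon>/2))" by (rule subsetD[OF K(2)]) (use that in simp)
    then have "\<exists>x. x \<in> K \<and> v \<in> ball x (\<epsilon>/2)" by blast
    then show ?thesis unfolding c_def by (rule someI_ex)
  qed
  show thesis
  proof
    show "e (c v) < q" if "cmod v \<le> R" for v
      using c[OF that] e by (auto simp: bij_betw_def)
    show "cmod (v - w) \<le> \<epsilon>" if vw: "cmod v \<le> R" "cmod w \<le> R" and eq: "e (c v) = e (c w)" for v w
    proof -
      have "c v = c w" using eq c[OF vw(1)] c[OF vw(2)] e by (auto simp: bij_betw_def inj_on_def)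
      then have "dist (c v) v < \<epsilon>/2" "dist (c v) w < \<epsilon>/2" using c[OF vw(1)] c[OF vw(2)] by auto
      then have "dist v w < \<epsilon>" by (metis dist_commute dist_triangle_half_r)
      then show ?thesis by (simp add: dist_norm)
    qed
  qed
qed

text \<open>
  A covering is given by its labels and has no centres.  So a covering of a larger set of functionals, or of
  its image under a map, induces one of the smaller set without any choice of new centres.
\<close>

definition sup_coverable :: "('a \<Rightarrow> complex) set \<Rightarrow> 'a set \<Rightarrow> real \<Rightarrow> real \<Rightarrow> bool" where
  "sup_coverable F P \<epsilon> N \<longleftrightarrow>
     (\<exists>L :: _ \<Rightarrow> nat. finite (L ` F) \<and> real (card (L ` F)) \<le> N \<and>
        (\<forall>f\<in>F. \<forall>g\<in>F. L f = L g \<longrightarrow> (\<forall>p\<in>P. cmod (f p - g p) \<le> \<epsilon>)))"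

lemma sup_coverableI:
  assumes H: "finite H" "\<And>f. f \<in> F \<Longrightarrow> L f \<in> H" "real (card H) \<le> N"
    and close: "\<And>f g p. f \<in> F \<Longrightarrow> g \<in> F \<Longrightarrow> L f = L g \<Longrightarrow> p \<in> P \<Longrightarrow> cmod (f p - g p) \<le> \<epsilon>"
  shows "sup_coverable F P \<epsilon> N"
proof -
  obtain e :: "_ \<Rightarrow> nat" where e: "inj_on e H"
    using finite_imp_inj_to_nat_seg[OF H(1)] by blast
  have sub: "L ` F \<subseteq> H" using H(2) by auto
  have "card ((\<lambda>f. e (L f)) ` F) \<le> card (L ` F)"
    using card_image_le[of "L ` F" e] finite_subset[OF sub H(1)] by (simp add: image_image)
  also have "\<dots> \<le> card H" by (rule card_mono[OF H(1) sub])
  finally have "real (card ((\<lambda>f. e (L f)) ` F)) \<le> N" using H(3) by simp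
  moreover have "finite ((\<lambda>f. e (L f)) ` F)"
    using finite_subset[OF sub H(1)] by (metis finite_imageI image_image)
  ultimately show ?thesis
    unfolding sup_coverable_def
    using e sub close by (intro exI[of _ "\<lambda>f. e (L f)"]) (auto simp: inj_on_def image_subset_iff)
qed

lemma sup_coverableE:
  assumes "sup_coverable F P \<epsilon> N"
  obtains L :: "_ \<Rightarrow> nat" where "finite (L ` F)" "real (card (L ` F)) \<le> N"
    "\<And>f g p. f \<in> F \<Longrightarrow> g \<in> F \<Longrightarrow> L f = L g \<Longrightarrow> p \<in> P \<Longrightarrow> cmod (f p - g p) \<le> \<epsilon>"
  using assms unfolding sup_coverable_def by blast

text \<open>
  The modulus is at most the sum of the moduli of the real and imaginary parts, hence at most twice the larger
  one.  So four phases and a factor 2, absorbed into the atoms below, replace the whole circle of phases.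
\<close>

lemma quadrant_rotation:
  "\<exists>t\<in>{1, -1, \<i>, -\<i>}. cmod w \<le> Re (2 * t * w)"
  using cmod_le[of w] by (auto simp: abs_if split: if_splits)

text \<open>
  The label of a functional \<open>b\<close> consists of a sparse average that approximates \<open>b\<close> in mean
  square, and of the rounded values of \<open>b\<close> at the few points at which the approximation is bad.  The
  point of the statement is that \<open>\<delta>\<close> and \<open>m\<close> are chosen before \<open>P\<close> and \<open>d\<close>.
\<close>

lemma sup_coverable_of_dual_bound:
  fixes R \<epsilon> \<theta> :: real
  assumes R: "R > 0" and \<epsilon>: "\<epsilon> > 0" and \<theta>: "\<theta> > 0"
  obtains \<delta> :: real and m :: nat where "\<delta> > 0"
    and "\<And>(P :: 'a set) d (A :: nat \<Rightarrow> 'a \<Rightarrow> complex) F.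
      finite P \<Longrightarrow>
      (\<And>k p. k < d \<Longrightarrow> p \<in> P \<Longrightarrow> cmod (A k p) \<le> R) \<Longrightarrow>
      (\<And>b p. b \<in> F \<Longrightarrow> p \<in> P \<Longrightarrow> cmod (b p) \<le> R) \<Longrightarrow>
      (\<And>b a. b \<in> F \<Longrightarrow> \<exists>k<d. cmod (\<Sum>p\<in>P. a p * b p)
          \<le> cmod (\<Sum>p\<in>P. a p * A k p) + \<delta> * (\<Sum>p\<in>P. cmod (a p))) \<Longrightarrow>
      sup_coverable F P \<epsilon> ((4 * real d) ^ m * exp (\<theta> * card P))"
proof -
  obtain q :: nat and r :: "complex \<Rightarrow> nat"
    where r_less: "\<And>v. cmod v \<le> R \<Longrightarrow> r v < q"
      and r_close: "\<And>v w. cmod v \<le> R \<Longrightarrow> cmod w \<le> R \<Longrightarrow> r v = r w \<Longrightarrow> cmod (v - w) \<le> \<epsilon>"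
    by (rule bounded_separating_labels[OF \<epsilon>, of R]) (rule that)
  \<comment> \<open>The weight \<open>\<kappa>\<close> keeps the factor \<open>1 + \<kappa> q\<close> per point below \<open>exp(\<theta>/2)\<close>;
    the proportion \<open>\<tau>\<close> of exceptional points keeps \<open>\<kappa> powr (- \<tau>)\<close> below \<open>exp(\<theta>/2)\<close>;
    the mean square error \<open>\<eta>\<close> ensures this proportion.\<close>
  define \<kappa> where "\<kappa> = min 1 (\<theta> / (2 * (q + 1)))"
  have \<kappa>: "0 < \<kappa>" "\<kappa> \<le> 1" using \<theta> by (auto simp: \<kappa>_def)
  have kq: "\<kappa> * q \<le> \<theta> / 2"
  proof -
    have "\<kappa> * q \<le> \<theta> / (2 * (q + 1)) * q"
      by (intro mult_right_mono) (auto simp: \<kappa>_def)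
    also have "\<dots> \<le> \<theta> / 2" using \<theta> by (simp add: field_simps)
    finally show ?thesis .
  qed
  define \<tau> where "\<tau> = \<theta> / (2 * (1 - ln \<kappa>))"
  have ln: "1 - ln \<kappa> \<ge> 1" using \<kappa> by simp
  have \<tau>: "\<tau> > 0" and \<tau>ln: "\<tau> * (- ln \<kappa>) \<le> \<theta> / 2"
    using \<theta> ln by (auto simp: \<tau>_def field_simps intro!: divide_pos_pos)
  define \<eta> where "\<eta> = \<tau> * (\<epsilon> / 2)\<^sup>2"
  have \<eta>: "\<eta> > 0" using \<tau> \<epsilon> by (simp add: \<eta>_def)
  define m where "m = nat \<lceil>32 * R\<^sup>2 / \<eta>\<rceil> + 1"
  have m: "m > 0" "16 * R\<^sup>2 / m \<le> \<eta> / 2"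
  proof -
    show "m > 0" by (simp add: m_def)
    have "32 * R\<^sup>2 / \<eta> \<le> m" unfolding m_def by linarith
    then show "16 * R\<^sup>2 / m \<le> \<eta> / 2" using \<eta> \<open>m > 0\<close> by (simp add: field_simps)
  qed
  define \<delta> where "\<delta> = \<eta> / (16 * R)"
  have \<delta>: "\<delta> > 0" "8 * R * \<delta> \<le> \<eta> / 2" using \<eta> R by (auto simp: \<delta>_def)
  show thesis
  proof (rule that[OF \<delta>(1)])
    fix P :: "'a set" and d and A :: "nat \<Rightarrow> 'a \<Rightarrow> complex" and F
    assume fin: "finite P"
      and A: "\<And>k p. k < d \<Longrightarrow> p \<in> P \<Longrightarrow> cmod (A k p) \<le> R"
      and F: "\<And>b p. b \<in> F \<Longrightarrow> p \<in> P \<Longrightarrow> cmod (b p) \<le> R"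
      and dual: "\<And>b a. b \<in> F \<Longrightarrow> \<exists>k<d. cmod (\<Sum>p\<in>P. a p * b p)
          \<le> cmod (\<Sum>p\<in>P. a p * A k p) + \<delta> * (\<Sum>p\<in>P. cmod (a p))"
    define J where "J = {1, -1, \<i>, -\<i>} \<times> {..<d}"
    define B where "B j p = 2 * fst j * A (snd j) p" for j p
    have card_J: "card J = 4 * d"
      unfolding J_def card_cartesian_product
      by (simp add: complex_eq_iff card_insert_if)
    have sparse: "\<exists>js. length js = m \<and> set js \<subseteq> J \<and>
        (\<Sum>p\<in>P. (cmod (of_nat m * b p - (\<Sum>j\<leftarrow>js. B j p)))\<^sup>2)
          \<le> card P * (4 * (2 * R)\<^sup>2 * m + 4 * (2 * R) * \<delta> * (real m)\<^sup>2)" if "b \<in> F" for b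
    proof (rule greedy_average[OF fin])
      show "cmod (b p) \<le> 2 * R" if "p \<in> P" for p
        using F[OF \<open>b \<in> F\<close> that] R by simp
      show "cmod (B j p) \<le> 2 * R" if "j \<in> J" "p \<in> P" for j p
        using that A by (auto simp: J_def B_def norm_mult)
      fix a :: "'a \<Rightarrow> complex"
      obtain k where k: "k < d" "cmod (\<Sum>p\<in>P. a p * b p)
          \<le> cmod (\<Sum>p\<in>P. a p * A k p) + \<delta> * (\<Sum>p\<in>P. cmod (a p))"
        using dual[OF \<open>b \<in> F\<close>] by blast
      obtain t where t: "t \<in> {1, -1, \<i>, -\<i>}"
        "cmod (\<Sum>p\<in>P. a p * A k p) \<le> Re (2 * t * (\<Sum>p\<in>P. a p * A k p))"
        using quadrant_rotation by blast
      have "2 * t * (\<Sum>p\<in>P. a p * A k p) = (\<Sum>p\<in>P. a p * B (t, k) p)"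
        by (simp add: B_def sum_distrib_left algebra_simps)
      then have "Re (\<Sum>p\<in>P. a p * b p)
          \<le> Re (\<Sum>p\<in>P. a p * B (t, k) p) + \<delta> * (\<Sum>p\<in>P. cmod (a p))"
        using k(2) t(2) complex_Re_le_cmod[of "\<Sum>p\<in>P. a p * b p"] by simp
      moreover have "(t, k) \<in> J" using t(1) k(1) by (simp add: J_def)
      ultimately show "\<exists>j\<in>J. Re (\<Sum>p\<in>P. a p * b p)
          \<le> Re (\<Sum>p\<in>P. a p * B j p) + \<delta> * (\<Sum>p\<in>P. cmod (a p))" by blast
    qed (use R \<delta> in auto)
    define js where "js b = (SOME js. length js = m \<and> set js \<subseteq> J \<and>
        (\<Sum>p\<in>P. (cmod (of_nat m * b p - (\<Sum>j\<leftarrow>js. B j p)))\<^sup>2)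
          \<le> card P * (4 * (2 * R)\<^sup>2 * m + 4 * (2 * R) * \<delta> * (real m)\<^sup>2))" for b
    note js_spec = someI_ex[OF sparse, folded js_def]
    have js: "length (js b) = m \<and> set (js b) \<subseteq> J" if "b \<in> F" for b
      using js_spec[OF that] by blast
    have js_err: "(\<Sum>p\<in>P. (cmod (of_nat m * b p - (\<Sum>j\<leftarrow>js b. B j p)))\<^sup>2)
          \<le> card P * (4 * (2 * R)\<^sup>2 * m + 4 * (2 * R) * \<delta> * (real m)\<^sup>2)" if "b \<in> F" for b
      using js_spec[OF that] by blast
    define z where "z b p = (\<Sum>j\<leftarrow>js b. B j p) / m" for b p
    have mean: "(\<Sum>p\<in>P. (cmod (b p - z b p))\<^sup>2) \<le> card P * \<eta>" if "b \<in> F" for b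
    proof -
      have "(cmod (of_nat m * b p - (\<Sum>j\<leftarrow>js b. B j p)))\<^sup>2 = (real m)\<^sup>2 * (cmod (b p - z b p))\<^sup>2" for p
      proof -
        have "of_nat m * b p - (\<Sum>j\<leftarrow>js b. B j p) = of_nat m * (b p - z b p)"
          using m(1) by (simp add: z_def field_simps)
        then show ?thesis by (simp add: norm_mult power_mult_distrib)
      qed
      then have "(real m)\<^sup>2 * (\<Sum>p\<in>P. (cmod (b p - z b p))\<^sup>2)
          \<le> card P * (4 * (2 * R)\<^sup>2 * m + 4 * (2 * R) * \<delta> * (real m)\<^sup>2)"
        using js_err[OF that] by (simp add: sum_distrib_left)
      also have "\<dots> = (real m)\<^sup>2 * (card P * (16 * R\<^sup>2 / m + 8 * R * \<delta>))"
        using m(1) by (simp add: field_simps power2_eq_square)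
      also have "\<dots> \<le> (real m)\<^sup>2 * (card P * \<eta>)"
        using m(2) \<delta>(2) by (intro mult_left_mono) auto
      finally show ?thesis using m(1) by simp
    qed
    \<comment> \<open>The value 0 marks the points at which the approximation is good.\<close>
    define h where "h b = (\<lambda>p\<in>P. if cmod (b p - z b p) \<le> \<epsilon> / 2 then 0 else r (b p) + 1)" for b
    define H where "H = {h \<in> P \<rightarrow>\<^sub>E {..q}. card {p\<in>P. h p \<noteq> 0} \<le> \<tau> * card P}"
    have finH: "finite H" unfolding H_def by (rule finite_subset[of _ "P \<rightarrow>\<^sub>E {..q}"]) (auto intro: finite_PiE fin)
    define Js where "Js = {xs. set xs \<subseteq> J \<and> length xs = m}"
    have finJ: "finite J" by (simp add: J_def)
    have finJs: "finite Js" and cardJs: "card Js = (4 * d) ^ m"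
      unfolding Js_def using finite_lists_length_eq[OF finJ] card_lists_length_eq[OF finJ] card_J by auto
    have h: "h b \<in> H" if "b \<in> F" for b
    proof -
      let ?S = "{p\<in>P. h b p \<noteq> 0}"
      have "card ?S * (\<epsilon> / 2)\<^sup>2 = (\<Sum>p\<in>?S. (\<epsilon> / 2)\<^sup>2)" by simp
      also have "\<dots> \<le> (\<Sum>p\<in>?S. (cmod (b p - z b p))\<^sup>2)"
        by (intro sum_mono power_mono) (use \<epsilon> in \<open>auto simp: h_def split: if_splits\<close>)
      also have "\<dots> \<le> (\<Sum>p\<in>P. (cmod (b p - z b p))\<^sup>2)"
        by (rule sum_mono2[OF fin]) auto
      also have "\<dots> \<le> card P * \<eta>" by (rule mean[OF that])
      finally have "card ?S * (\<epsilon> / 2)\<^sup>2 \<le> (\<tau> * card P) * (\<epsilon> / 2)\<^sup>2" by (simp only: \<eta>_def mult_ac)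
      then have "card ?S \<le> \<tau> * card P"
        using \<epsilon> by (meson half_gt_zero mult_le_cancel_right_pos zero_less_power)
      then show ?thesis
        using r_less[OF F[OF that]] by (fastforce simp: H_def h_def)
    qed
    have "real (card (Js \<times> H)) \<le> (4 * real d) ^ m * exp (\<theta> * card P)"
    proof -
      have "real (card H) \<le> (1 + \<kappa> * q) ^ card P * \<kappa> powr (- (\<tau> * card P))"
        unfolding H_def by (rule card_PiE_few_nonzero[OF fin \<kappa>])
      also have "\<dots> \<le> exp (\<kappa> * q) ^ card P * exp (\<tau> * (- ln \<kappa>) * card P)"
        using \<kappa> by (intro mult_mono power_mono exp_ge_add_one_self)
          (auto simp: powr_def algebra_simps)
      also have "\<dots> = exp ((\<kappa> * q + \<tau> * (- ln \<kappa>)) * card P)"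
        by (simp add: exp_of_nat_mult[symmetric] exp_add[symmetric] algebra_simps)
      also have "\<dots> \<le> exp (\<theta> * card P)"
        using kq \<tau>ln by (simp add: mult_right_mono)
      finally show ?thesis
        by (simp add: card_cartesian_product cardJs mult_left_mono)
    qed
    then show "sup_coverable F P \<epsilon> ((4 * real d) ^ m * exp (\<theta> * card P))"
    proof (rule sup_coverableI[rotated 2, where L = "\<lambda>b. (js b, h b)"])
      show "finite (Js \<times> H)" using finJs finH by simp
      show "(js b, h b) \<in> Js \<times> H" if "b \<in> F" for b
        using js[OF that] h[OF that] by (simp add: Js_def)
      fix b c p assume bc: "b \<in> F" "c \<in> F" and eq: "(js b, h b) = (js c, h c)" and p: "p \<in> P"
      from eq have z: "z b p = z c p" and "h b p = h c p" by (simp_all add: z_def)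
      then consider "cmod (b p - z b p) \<le> \<epsilon> / 2" "cmod (c p - z c p) \<le> \<epsilon> / 2" | "r (b p) = r (c p)"
        using p by (auto simp: h_def split: if_splits)
      then show "cmod (b p - c p) \<le> \<epsilon>"
      proof cases
        case 1
        then show ?thesis
          using norm_triangle_ineq4[of "b p - z b p" "c p - z c p"] z by simp
      next
        case 2
        then show ?thesis using r_close F bc p by blast
      qed
    qed
  qed
qed


section \<open>Linear combinations in complex normed spaces\<close>

lemma complex_field_simps [simp]:
  "carrier complex_field = UNIV" "x \<oplus>\<^bsub>complex_field\<^esub> y = x + y"
  "x \<otimes>\<^bsub>complex_field\<^esub> y = x * y" "\<one>\<^bsub>complex_field\<^esub> = 1" "\<zero>\<^bsub>complex_field\<^esub> = 0"
  by (simp_all add: complex_field_def)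

context complex_normed_space
begin

lemma smult_in_carrier [simp, intro]: "x \<in> carrier X \<Longrightarrow> c \<odot> x \<in> carrier X"
  using smult_closed[of c x] by simp

lemma smult_zero_left [simp]: "x \<in> carrier X \<Longrightarrow> 0 \<odot> x = \<zero>"
  using smult_l_null[of x] by simp

lemma minus_eq_smult: "x \<in> carrier X \<Longrightarrow> \<ominus> x = (-1) \<odot> x"
proof -
  assume x: "x \<in> carrier X"
  have "(-1) \<odot> x \<oplus> x = (-1 + 1) \<odot> x"
    using smult_l_distr[of "-1" 1 x] smult_one[of x] x by simp
  then show ?thesis using x by (intro M.minus_equality) auto
qed

lemma nrm_zero [simp]: "nrm X \<zero> = 0"
  using nrm_eq_0_iff[of \<zero>] by simp

lemma nrm_uminus [simp]: "x \<in> carrier X \<Longrightarrow> nrm X (\<ominus> x) = nrm X x"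
  by (simp add: minus_eq_smult nrm_smult)

lemma nrm_nonneg [simp]: "x \<in> carrier X \<Longrightarrow> 0 \<le> nrm X x"
  using nrm_triangle[of x "\<ominus> x"] by (simp add: M.r_neg)

lemma nrm_diff_triangle:
  assumes "x \<in> carrier X" "y \<in> carrier X" "z \<in> carrier X"
  shows "nrm X (x \<ominus> z) \<le> nrm X (x \<ominus> y) + nrm X (y \<ominus> z)"
proof -
  have "x \<ominus> z = (x \<ominus> y) \<oplus> (y \<ominus> z)"
    using assms by (simp add: M.minus_eq M.a_ac M.r_neg1 M.r_neg2)
  then show ?thesis using assms nrm_triangle[of "x \<ominus> y" "y \<ominus> z"] by simp
qed

lemma nrm_le_add_diff:
  assumes "x \<in> carrier X" "y \<in> carrier X"
  shows "nrm X y \<le> nrm X x + nrm X (x \<ominus> y)"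
proof -
  have "y = x \<oplus> \<ominus> (x \<ominus> y)"
    using assms by (simp add: M.minus_eq M.minus_add M.a_assoc[symmetric] M.r_neg)
  then show ?thesis using assms nrm_triangle[of x "\<ominus> (x \<ominus> y)"] by simp
qed

end

definition linear_functional :: "'a normed_space \<Rightarrow> ('a \<Rightarrow> complex) \<Rightarrow> bool" where
  "linear_functional X f \<longleftrightarrow>
     (\<forall>x\<in>carrier X. \<forall>y\<in>carrier X. f (x \<oplus>\<^bsub>X\<^esub> y) = f x + f y) \<and>
     (\<forall>c. \<forall>x\<in>carrier X. f (c \<odot>\<^bsub>X\<^esub> x) = c * f x)"

definition dual_ball :: "'a normed_space \<Rightarrow> ('a \<Rightarrow> complex) set" where
  "dual_ball X = {f. linear_functional X f \<and> (\<forall>x\<in>carrier X. cmod (f x) \<le> nrm X x)}"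

definition lincomb :: "'a normed_space \<Rightarrow> ('a \<Rightarrow> complex) \<Rightarrow> 'a set \<Rightarrow> 'a" where
  "lincomb X a P = (\<Oplus>\<^bsub>X\<^esub>p\<in>P. a p \<odot>\<^bsub>X\<^esub> p)"

context complex_normed_space
begin

lemma lincomb_empty [simp]: "lincomb X a {} = \<zero>"
  by (simp add: lincomb_def)

lemma lincomb_closed [simp, intro]: "P \<subseteq> carrier X \<Longrightarrow> lincomb X a P \<in> carrier X"
  unfolding lincomb_def by (rule M.finsum_closed) auto

lemma lincomb_insert:
  "finite P \<Longrightarrow> p \<notin> P \<Longrightarrow> insert p P \<subseteq> carrier X \<Longrightarrow>
    lincomb X a (insert p P) = a p \<odot> p \<oplus> lincomb X a P"
  unfolding lincomb_def by (rule M.finsum_insert) auto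

lemma linear_functional_lincomb:
  assumes "linear_functional X f" "finite P" "P \<subseteq> carrier X"
  shows "f (lincomb X a P) = (\<Sum>p\<in>P. a p * f p)"
  using assms(2,3)
proof (induction P)
  case empty
  have "f (0 \<odot> \<zero>) = 0 * f \<zero>"
    using assms(1) unfolding linear_functional_def by blast
  then show ?case by simp
next
  case (insert p P)
  then have "f (a p \<odot> p \<oplus> lincomb X a P) = f (a p \<odot> p) + f (lincomb X a P)"
    using assms(1) unfolding linear_functional_def by auto
  moreover have "f (a p \<odot> p) = a p * f p"
    using assms(1) insert unfolding linear_functional_def by auto
  ultimately show ?case using insert by (simp add: lincomb_insert)
qed

lemma nrm_lincomb_le:
  assumes "finite P" "P \<subseteq> carrier X"
  shows "nrm X (lincomb X a P) \<le> (\<Sum>p\<in>P. cmod (a p) * nrm X p)"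
  using assms
proof (induction P)
  case (insert p P)
  then show ?case
    using nrm_triangle[of "a p \<odot> p" "lincomb X a P"]
    by (auto simp: lincomb_insert nrm_smult)
qed simp

lemma lincomb_scale:
  assumes "finite P" "P \<subseteq> carrier X"
  shows "lincomb X (\<lambda>p. c * a p) P = c \<odot>\<^bsub>X\<^esub> lincomb X a P"
proof -
  have "c \<odot>\<^bsub>X\<^esub> (\<Oplus>\<^bsub>X\<^esub>p\<in>P. a p \<odot>\<^bsub>X\<^esub> p) = (\<Oplus>\<^bsub>X\<^esub>p\<in>P. c \<odot>\<^bsub>X\<^esub> (a p \<odot>\<^bsub>X\<^esub> p))"
    using assms by (intro finsum_smult_ldistr) auto
  also have "\<dots> = (\<Oplus>\<^bsub>X\<^esub>p\<in>P. (c * a p) \<odot>\<^bsub>X\<^esub> p)"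
    using assms smult_assoc1[of c] by (intro M.finsum_cong') auto
  finally show ?thesis by (simp add: lincomb_def)
qed

lemma lincomb_add:
  assumes "finite P" "P \<subseteq> carrier X"
  shows "lincomb X (\<lambda>p. a p + b p) P = lincomb X a P \<oplus>\<^bsub>X\<^esub> lincomb X b P"
proof -
  have "lincomb X (\<lambda>p. a p + b p) P = (\<Oplus>\<^bsub>X\<^esub>p\<in>P. a p \<odot>\<^bsub>X\<^esub> p \<oplus>\<^bsub>X\<^esub> b p \<odot>\<^bsub>X\<^esub> p)"
    unfolding lincomb_def using assms smult_l_distr by (intro M.finsum_cong') auto
  also have "\<dots> = lincomb X a P \<oplus>\<^bsub>X\<^esub> lincomb X b P"
    unfolding lincomb_def using assms by (intro M.finsum_addf) auto
  finally show ?thesis .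
qed

end

lemma linear_map_comp:
  "linear_map X Y f \<Longrightarrow> linear_map Y Z g \<Longrightarrow> linear_map X Z (\<lambda>x. g (f x))"
  unfolding linear_map_def by (simp add: Pi_iff)

lemma contractive_map_comp:
  assumes f: "contractive_map X Y f" and g: "contractive_map Y Z g"
  shows "contractive_map X Z (\<lambda>x. g (f x))"
proof -
  have "nrm Z (g (f x)) \<le> nrm X x" if x: "x \<in> carrier X" for x
  proof -
    have "f x \<in> carrier Y" using f x unfolding contractive_map_def linear_map_def by blast
    then have "nrm Z (g (f x)) \<le> nrm Y (f x)" using g unfolding contractive_map_def by blast
    also have "\<dots> \<le> nrm X x" using f x unfolding contractive_map_def by blast
    finally show ?thesis .
  qed
  then show ?thesis
    using f g linear_map_comp unfolding contractive_map_def by blast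
qed

lemma linear_map_zero:
  assumes "complex_normed_space X" "complex_normed_space E" "linear_map X E u"
  shows "u \<zero>\<^bsub>X\<^esub> = \<zero>\<^bsub>E\<^esub>"
proof -
  interpret X: complex_normed_space X by fact
  interpret E: complex_normed_space E by fact
  have "u (0 \<odot>\<^bsub>X\<^esub> \<zero>\<^bsub>X\<^esub>) = 0 \<odot>\<^bsub>E\<^esub> u \<zero>\<^bsub>X\<^esub>"
    using assms(3) X.M.zero_closed unfolding linear_map_def by blast
  moreover have "u \<zero>\<^bsub>X\<^esub> \<in> carrier E"
    using assms(3) X.M.zero_closed unfolding linear_map_def by blast
  ultimately show ?thesis by simp
qed

lemma nrm_diff_lincomb_le:
  assumes "complex_normed_space X" "complex_normed_space E"
    and u: "linear_map X E u" and v: "linear_map X E v"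
    and P: "finite P" "P \<subseteq> carrier X"
    and close: "\<And>p. p \<in> P \<Longrightarrow> nrm E (u p \<ominus>\<^bsub>E\<^esub> v p) \<le> \<delta>"
  shows "nrm E (u (lincomb X a P) \<ominus>\<^bsub>E\<^esub> v (lincomb X a P)) \<le> \<delta> * (\<Sum>p\<in>P. cmod (a p))"
proof -
  interpret X: complex_normed_space X by fact
  interpret E: complex_normed_space E by fact
  have uv: "u x \<in> carrier E" "v x \<in> carrier E" if "x \<in> carrier X" for x
    using u v that unfolding linear_map_def by auto
  show ?thesis
    using P close
  proof (induction P)
    case empty
    have "u \<zero>\<^bsub>X\<^esub> = \<zero>\<^bsub>E\<^esub>" "v \<zero>\<^bsub>X\<^esub> = \<zero>\<^bsub>E\<^esub>"
      using linear_map_zero assms by auto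
    then show ?case by (simp add: E.M.minus_eq)
  next
    case (insert p P)
    let ?s = "lincomb X a P"
    have p: "p \<in> carrier X" and s: "?s \<in> carrier X" using insert by auto
    have expand: "w (a p \<odot>\<^bsub>X\<^esub> p \<oplus>\<^bsub>X\<^esub> ?s) = a p \<odot>\<^bsub>E\<^esub> w p \<oplus>\<^bsub>E\<^esub> w ?s"
      if "linear_map X E w" for w
      using that p s X.smult_in_carrier unfolding linear_map_def by simp
    have "u (a p \<odot>\<^bsub>X\<^esub> p \<oplus>\<^bsub>X\<^esub> ?s) \<ominus>\<^bsub>E\<^esub> v (a p \<odot>\<^bsub>X\<^esub> p \<oplus>\<^bsub>X\<^esub> ?s)
        = a p \<odot>\<^bsub>E\<^esub> (u p \<ominus>\<^bsub>E\<^esub> v p) \<oplus>\<^bsub>E\<^esub> (u ?s \<ominus>\<^bsub>E\<^esub> v ?s)"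
      using uv[OF p] uv[OF s] E.smult_r_minus[of "a p" "v p"]
      by (simp add: expand[OF u] expand[OF v] E.M.minus_eq E.M.minus_add E.smult_r_distr E.M.a_ac)
    also have "nrm E \<dots> \<le> nrm E (a p \<odot>\<^bsub>E\<^esub> (u p \<ominus>\<^bsub>E\<^esub> v p)) + nrm E (u ?s \<ominus>\<^bsub>E\<^esub> v ?s)"
      using uv[OF p] uv[OF s] by (intro E.nrm_triangle) auto
    also have "\<dots> \<le> cmod (a p) * \<delta> + \<delta> * (\<Sum>p\<in>P. cmod (a p))"
      using uv[OF p] insert by (intro add_mono) (auto simp: E.nrm_smult intro!: mult_left_mono)
    finally show ?case
      using insert by (simp add: X.lincomb_insert algebra_simps)
  qed
qed


section \<open>Factorizations and coverings of the dual unit ball\<close>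

lemma nrm_linf_le: "d > 0 \<Longrightarrow> (\<And>k. k < d \<Longrightarrow> cmod (v k) \<le> r) \<Longrightarrow> nrm (linf d) v \<le> r"
  by (auto simp: linf_def intro!: Max.boundedI)

lemma coordinate_le_nrm_linf: "k < d \<Longrightarrow> cmod (v k) \<le> nrm (linf d) v"
  by (auto simp: linf_def intro!: Max_ge)

lemma nrm_linf_attained: "d > 0 \<Longrightarrow> \<exists>k<d. nrm (linf d) v = cmod (v k)"
proof -
  assume "d > 0"
  then have "(MAX i\<in>{..<d}. cmod (v i)) \<in> (\<lambda>i. cmod (v i)) ` {..<d}"
    by (intro Max_in) auto
  then show ?thesis by (auto simp: linf_def)
qed

lemma linear_functional_coordinate:
  "linear_map X (linf d) \<Phi> \<Longrightarrow> linear_functional X (\<lambda>x. \<Phi> x k)"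
  by (simp add: linear_map_def linear_functional_def linf_def)

text \<open>
  The norm of the image of a linear combination in \<open>E\<close> is seen, up to \<open>\<delta>\<close> times the
  \<open>\<ell>\<^sub>1\<close> norm of the coefficients, by a single coordinate of the factorization.  The map \<open>v\<close>
  is \<open>\<iota>\<close> itself for a factorization of \<open>X\<close>, and \<open>\<iota> \<circ> Q\<close> for one of the
  quotient.
\<close>

lemma nrm_lincomb_le_coordinate:
  assumes X: "complex_normed_space X" and E: "complex_normed_space E" and d: "d > 0"
    and \<Phi>: "linear_map X (linf d) \<Phi>" and \<psi>: "contractive_map (linf d) E \<psi>" and v: "linear_map X E v"
    and P: "finite P" "P \<subseteq> carrier X"
    and close: "\<And>p. p \<in> P \<Longrightarrow> nrm E (\<psi> (\<Phi> p) \<ominus>\<^bsub>E\<^esub> v p) \<le> \<delta>"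
  shows "\<exists>k<d. nrm E (v (lincomb X a P)) \<le> cmod (\<Sum>p\<in>P. a p * \<Phi> p k) + \<delta> * (\<Sum>p\<in>P. cmod (a p))"
proof -
  interpret X: complex_normed_space X by fact
  interpret E: complex_normed_space E by fact
  let ?s = "lincomb X a P"
  have s: "?s \<in> carrier X" using P by auto
  have u: "linear_map X E (\<lambda>x. \<psi> (\<Phi> x))"
    using \<Phi> \<psi> linear_map_comp unfolding contractive_map_def by blast
  have carr: "\<psi> (\<Phi> ?s) \<in> carrier E" "v ?s \<in> carrier E" "\<Phi> ?s \<in> carrier (linf d)"
    using s u v \<Phi> unfolding linear_map_def by auto
  obtain k where k: "k < d" "nrm (linf d) (\<Phi> ?s) = cmod (\<Phi> ?s k)"
    using nrm_linf_attained[OF d] by blast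
  have "nrm E (v ?s) \<le> nrm E (\<psi> (\<Phi> ?s)) + nrm E (\<psi> (\<Phi> ?s) \<ominus>\<^bsub>E\<^esub> v ?s)"
    by (rule E.nrm_le_add_diff[OF carr(1,2)])
  also have "nrm E (\<psi> (\<Phi> ?s)) \<le> nrm (linf d) (\<Phi> ?s)"
    using \<psi> carr(3) unfolding contractive_map_def by blast
  also have "nrm E (\<psi> (\<Phi> ?s) \<ominus>\<^bsub>E\<^esub> v ?s) \<le> \<delta> * (\<Sum>p\<in>P. cmod (a p))"
    by (rule nrm_diff_lincomb_le[OF X E u v P close])
  finally show ?thesis
    using k X.linear_functional_lincomb[OF linear_functional_coordinate[OF \<Phi>, of k] P, of a]
    by (intro exI[of _ k]) auto
qed

text \<open>
  For \<open>f\<close> in the dual ball and a linear combination \<open>s\<close> of points of \<open>P\<close>, the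
  number \<open>|f s|\<close> is at most the norm of \<open>s\<close>, which is that of \<open>\<iota> s\<close> and hence is
  bounded by a coordinate of \<open>\<phi> s\<close>.
\<close>

lemma dual_ball_sup_coverable:
  fixes R \<epsilon> \<theta> :: real
  assumes "R > 0" "\<epsilon> > 0" "\<theta> > 0"
  obtains \<delta> :: real and m :: nat where "\<delta> > 0"
    and "\<And>(X :: 'a normed_space) (E :: 'b normed_space) \<iota> P \<phi> \<psi> d.
      complex_normed_space X \<Longrightarrow> complex_normed_space E \<Longrightarrow> isometric_map X E \<iota> \<Longrightarrow>
      finite P \<Longrightarrow> P \<subseteq> carrier X \<Longrightarrow> (\<And>p. p \<in> P \<Longrightarrow> nrm X p \<le> R) \<Longrightarrow>
      (\<phi>, \<psi>, d) \<in> CA X E \<iota> P \<delta> \<Longrightarrow>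
      sup_coverable (dual_ball X) P \<epsilon> ((4 * real d) ^ m * exp (\<theta> * card P))"
proof (rule sup_coverable_of_dual_bound[OF assms, where 'a='a])
  fix \<delta> :: real and m :: nat
  assume \<delta>: "\<delta> > 0"
    and core: "\<And>(P :: 'a set) d (A :: nat \<Rightarrow> 'a \<Rightarrow> complex) F.
      finite P \<Longrightarrow>
      (\<And>k p. k < d \<Longrightarrow> p \<in> P \<Longrightarrow> cmod (A k p) \<le> R) \<Longrightarrow>
      (\<And>b p. b \<in> F \<Longrightarrow> p \<in> P \<Longrightarrow> cmod (b p) \<le> R) \<Longrightarrow>
      (\<And>b a. b \<in> F \<Longrightarrow> \<exists>k<d. cmod (\<Sum>p\<in>P. a p * b p)
          \<le> cmod (\<Sum>p\<in>P. a p * A k p) + \<delta> * (\<Sum>p\<in>P. cmod (a p))) \<Longrightarrow>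
      sup_coverable F P \<epsilon> ((4 * real d) ^ m * exp (\<theta> * card P))"
  show thesis
  proof (rule that[OF \<delta>])
    fix X :: "'a normed_space" and E :: "'b normed_space" and \<iota> P \<phi> \<psi> d
    assume X: "complex_normed_space X" and E: "complex_normed_space E" and \<iota>: "isometric_map X E \<iota>"
      and P: "finite P" "P \<subseteq> carrier X" and R: "\<And>p. p \<in> P \<Longrightarrow> nrm X p \<le> R"
      and CA: "(\<phi>, \<psi>, d) \<in> CA X E \<iota> P \<delta>"
    from CA have d: "d > 0" and \<phi>: "contractive_map X (linf d) \<phi>" and \<psi>: "contractive_map (linf d) E \<psi>"
      and close: "\<And>p. p \<in> P \<Longrightarrow> nrm E (\<psi> (\<phi> p) \<ominus>\<^bsub>E\<^esub> \<iota> p) < \<delta>" by (auto simp: CA_def)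
    interpret X: complex_normed_space X by fact
    show "sup_coverable (dual_ball X) P \<epsilon> ((4 * real d) ^ m * exp (\<theta> * card P))"
    proof (rule core[OF P(1), where A = "\<lambda>k p. \<phi> p k"])
      show "cmod (\<phi> p k) \<le> R" if "k < d" "p \<in> P" for k p
        using coordinate_le_nrm_linf[OF that(1), of "\<phi> p"] \<phi> that P R[OF that(2)]
        unfolding contractive_map_def by force
      show "cmod (b p) \<le> R" if "b \<in> dual_ball X" "p \<in> P" for b p
        using that P R[OF that(2)] unfolding dual_ball_def by force
      fix b a assume b: "b \<in> dual_ball X"
      obtain k where k: "k < d" "nrm E (\<iota> (lincomb X a P))
          \<le> cmod (\<Sum>p\<in>P. a p * \<phi> p k) + \<delta> * (\<Sum>p\<in>P. cmod (a p))"
        using nrm_lincomb_le_coordinate[OF X E d _ \<psi> _ P, of \<phi> \<iota> \<delta> a] \<phi> \<iota> close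
        unfolding contractive_map_def isometric_map_def by (meson less_imp_le)
      have "cmod (\<Sum>p\<in>P. a p * b p) = cmod (b (lincomb X a P))"
        using b X.linear_functional_lincomb[of b, OF _ P] by (simp add: dual_ball_def)
      also have "\<dots> \<le> nrm X (lincomb X a P)"
        using b P unfolding dual_ball_def by auto
      also have "\<dots> = nrm E (\<iota> (lincomb X a P))"
        using \<iota> P unfolding isometric_map_def by auto
      finally show "\<exists>k<d. cmod (\<Sum>p\<in>P. a p * b p)
          \<le> cmod (\<Sum>p\<in>P. a p * \<phi> p k) + \<delta> * (\<Sum>p\<in>P. cmod (a p))"
        using k by auto
    qed
  qed
qed

text \<open>
  The CA embedding supplies a factorization through tuples of some uncontrolled length \<open>d\<close>.  Its
  coordinates lie in the dual ball; replace each of them by the representative of its label.  The new first map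
  \<open>\<Phi>\<close> lists the representatives, and \<open>\<sigma>\<close> copies each of them to the places where it is
  needed.
\<close>

lemma CA_of_sup_coverable:
  assumes \<iota>: "CA_embedding X E \<iota>"
    and P: "finite P" "P \<subseteq> carrier X" and \<epsilon>: "\<epsilon> < \<delta>"
    and cov: "sup_coverable (dual_ball X) P \<epsilon> N"
  shows "\<exists>\<phi> \<psi> d. (\<phi>, \<psi>, d) \<in> CA X E \<iota> P \<delta> \<and> real d \<le> N"
proof -
  interpret E: complex_normed_space E using \<iota> by (simp add: CA_embedding_def banach_space_def)
  obtain L :: "('a \<Rightarrow> complex) \<Rightarrow> nat" where L: "finite (L ` dual_ball X)" "card (L ` dual_ball X) \<le> N"
    and close: "\<And>f g p. f \<in> dual_ball X \<Longrightarrow> g \<in> dual_ball X \<Longrightarrow> L f = L g \<Longrightarrow> p \<in> P \<Longrightarrow> cmod (f p - g p) \<le> \<epsilon>"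
    by (rule sup_coverableE[OF cov]) (rule that)
  define n where "n = card (L ` dual_ball X)"
  obtain e where e: "bij_betw e (L ` dual_ball X) {..<n}"
    using ex_bij_betw_finite_nat[OF L(1)] by (auto simp: atLeast0LessThan n_def)
  have zero: "(\<lambda>x. 0) \<in> dual_ball X" 
  proof -
    have "0 \<le> nrm X x" if "x \<in> carrier X" for x
    proof -
      have "nrm E (\<iota> x) = nrm X x" "\<iota> x \<in> carrier E"
        using \<iota> that unfolding CA_embedding_def isometric_map_def linear_map_def by auto
      then show ?thesis using E.nrm_nonneg by metis
    qed
    then show ?thesis by (simp add: dual_ball_def linear_functional_def)
  qed
  then have n: "n > 0" unfolding n_def using L(1) by (auto simp: card_gt_0_iff)
  have "\<exists>g. g \<in> dual_ball X \<and> e (L g) = l" if "l < n" for l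
  proof -
    have "l \<in> e ` L ` dual_ball X" using e that by (simp add: bij_betw_def)
    then show ?thesis by blast
  qed
  then obtain rep where rep: "\<And>l. l < n \<Longrightarrow> rep l \<in> dual_ball X" "\<And>l. l < n \<Longrightarrow> e (L (rep l)) = l"
    by metis
  define \<Phi> where "\<Phi> x l = (if l < n then rep l x else 0)" for x l
  have \<Phi>_lin: "linear_map X (linf n) \<Phi>"
    using rep(1) unfolding linear_map_def
    by (auto simp: \<Phi>_def linf_def fun_eq_iff dual_ball_def linear_functional_def)
  have \<Phi>: "contractive_map X (linf n) \<Phi>"
    unfolding contractive_map_def using \<Phi>_lin rep(1)
    by (auto intro!: nrm_linf_le n simp: \<Phi>_def dual_ball_def)
  have "0 < \<delta> - \<epsilon>" using \<epsilon> by simp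
  then have "CA X E \<iota> P (\<delta> - \<epsilon>) \<noteq> {}"
    using \<iota> P unfolding CA_embedding_def by blast
  then obtain \<phi> \<psi> d where "(\<phi>, \<psi>, d) \<in> CA X E \<iota> P (\<delta> - \<epsilon>)"
    by (metis equals0I prod_cases3)
  then have d: "d > 0" and \<phi>: "contractive_map X (linf d) \<phi>" and \<psi>: "contractive_map (linf d) E \<psi>"
    and \<phi>\<psi>: "\<And>p. p \<in> P \<Longrightarrow> nrm E (\<psi> (\<phi> p) \<ominus>\<^bsub>E\<^esub> \<iota> p) < \<delta> - \<epsilon>" by (auto simp: CA_def)
  have coord: "(\<lambda>x. \<phi> x j) \<in> dual_ball X" if "j < d" for j
  proof -
    have "cmod (\<phi> x j) \<le> nrm X x" if "x \<in> carrier X" for x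
    proof -
      have "nrm (linf d) (\<phi> x) \<le> nrm X x" using \<phi> that unfolding contractive_map_def by blast
      then show ?thesis using coordinate_le_nrm_linf[OF \<open>j < d\<close>, of "\<phi> x"] by linarith
    qed
    moreover have "linear_functional X (\<lambda>x. \<phi> x j)"
      using \<phi> unfolding contractive_map_def by (intro linear_functional_coordinate) blast
    ultimately show ?thesis by (simp add: dual_ball_def)
  qed
  define s where "s j = e (L (\<lambda>x. \<phi> x j))" for j
  have s: "s j < n" if "j < d" for j
    using e coord[OF that] unfolding bij_betw_def s_def by auto
  have Ls: "L (rep (s j)) = L (\<lambda>x. \<phi> x j)" if "j < d" for j
    using rep[OF s[OF that]] e coord[OF that] unfolding s_def bij_betw_def inj_on_def by blast
  \<comment> \<open>Coordinate \<open>j\<close> of a \<open>d\<close>-tuple is copied from the place that its label has among the \<open>n\<close> labels.\<close>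
  define \<sigma> where "\<sigma> v j = (if j < d then v (s j) else 0)" for v :: "nat \<Rightarrow> complex" and j
  have \<sigma>: "contractive_map (linf n) (linf d) \<sigma>"
  proof -
    have "linear_map (linf n) (linf d) \<sigma>"
      by (auto simp: linear_map_def linf_def \<sigma>_def fun_eq_iff)
    moreover have "nrm (linf d) (\<sigma> v) \<le> nrm (linf n) v" for v
      using s by (intro nrm_linf_le d) (auto simp: \<sigma>_def intro!: coordinate_le_nrm_linf)
    ultimately show ?thesis by (simp add: contractive_map_def)
  qed
  have \<psi>\<sigma>: "contractive_map (linf n) E (\<lambda>v. \<psi> (\<sigma> v))"
    by (rule contractive_map_comp[OF \<sigma> \<psi>])
  have "nrm E (\<psi> (\<sigma> (\<Phi> p)) \<ominus>\<^bsub>E\<^esub> \<iota> p) < \<delta>" if p: "p \<in> P" for p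
  proof -
    let ?v = "\<sigma> (\<Phi> p)" and ?w = "\<phi> p"
    let ?z = "\<lambda>j. ?v j - ?w j"
    have pX: "p \<in> carrier X" using p P by auto
    have w: "?w \<in> carrier (linf d)" and v: "?v \<in> carrier (linf d)"
      using \<phi> \<sigma> \<Phi> pX unfolding contractive_map_def linear_map_def by (auto simp: Pi_iff)
    then have z: "?z \<in> carrier (linf d)" by (auto simp: linf_def)
    have "\<psi> (?z \<oplus>\<^bsub>linf d\<^esub> ?w) = \<psi> ?z \<oplus>\<^bsub>E\<^esub> \<psi> ?w"
      using \<psi> z w unfolding contractive_map_def linear_map_def by blast
    moreover have "?z \<oplus>\<^bsub>linf d\<^esub> ?w = ?v" by (simp add: linf_def)
    ultimately have "\<psi> ?v = \<psi> ?z \<oplus>\<^bsub>E\<^esub> \<psi> ?w" by simp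
    moreover have c: "\<psi> ?v \<in> carrier E" "\<psi> ?z \<in> carrier E" "\<psi> ?w \<in> carrier E" "\<iota> p \<in> carrier E"
      using \<psi> v w z \<iota> pX unfolding contractive_map_def linear_map_def CA_embedding_def isometric_map_def by auto
    ultimately have "\<psi> ?v \<ominus>\<^bsub>E\<^esub> \<psi> ?w = \<psi> ?z"
      by (simp add: E.M.minus_eq E.M.a_assoc E.M.r_neg)
    moreover have "nrm E (\<psi> ?z) \<le> nrm (linf d) ?z"
      using \<psi> z unfolding contractive_map_def by blast
    moreover have "nrm (linf d) ?z \<le> \<epsilon>"
      using close[OF rep(1)[OF s] coord Ls p] s
      by (intro nrm_linf_le d) (simp add: \<sigma>_def \<Phi>_def)
    moreover have "nrm E (\<psi> ?v \<ominus>\<^bsub>E\<^esub> \<iota> p) \<le> nrm E (\<psi> ?v \<ominus>\<^bsub>E\<^esub> \<psi> ?w) + nrm E (\<psi> ?w \<ominus>\<^bsub>E\<^esub> \<iota> p)"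
      by (rule E.nrm_diff_triangle) (use c in auto)
    ultimately show ?thesis using \<phi>\<psi>[OF p] by simp
  qed
  then have "(\<Phi>, \<lambda>v. \<psi> (\<sigma> v), n) \<in> CA X E \<iota> P \<delta>"
    using n \<Phi> \<psi>\<sigma> by (auto simp: CA_def)
  then show ?thesis using L(2) unfolding n_def by blast
qed


section \<open>Subexponential growth along orbits\<close>

abbreviation orbit :: "('a \<Rightarrow> 'a) \<Rightarrow> 'a set \<Rightarrow> nat \<Rightarrow> 'a set" where
  "orbit \<alpha> \<Omega> n \<equiv> (\<Union>k<n. (\<alpha> ^^ k) ` \<Omega>)"

text \<open>
  This is the vanishing of \<open>hc\<close>, without the infimum, the logarithm and the limit superior.
\<close>

definition subexp_factorable ::
  "'a normed_space \<Rightarrow> 'b normed_space \<Rightarrow> ('a \<Rightarrow> 'b) \<Rightarrow> ('a \<Rightarrow> 'a) \<Rightarrow> bool" where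
  "subexp_factorable X E \<iota> \<alpha> \<longleftrightarrow>
     (\<forall>\<Omega> \<delta> \<theta>. finite \<Omega> \<longrightarrow> \<Omega> \<subseteq> carrier X \<longrightarrow> \<delta> > 0 \<longrightarrow> \<theta> > 0 \<longrightarrow>
        (\<forall>\<^sub>F n in sequentially. \<exists>\<phi> \<psi> d.
           (\<phi>, \<psi>, d) \<in> CA X E \<iota> (orbit \<alpha> \<Omega> n) \<delta> \<and> real d \<le> exp (\<theta> * real n)))"

text \<open>
  This is the vanishing of the topological entropy of the adjoint of \<open>\<alpha>\<close> on the dual unit ball
  with its weak\<open>\<^sup>*\<close> topology.
\<close>

definition subexp_coverable :: "'a normed_space \<Rightarrow> ('a \<Rightarrow> 'a) \<Rightarrow> bool" where
  "subexp_coverable X \<alpha> \<longleftrightarrow>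
     (\<forall>\<Omega> \<epsilon> \<theta>. finite \<Omega> \<longrightarrow> \<Omega> \<subseteq> carrier X \<longrightarrow> \<epsilon> > 0 \<longrightarrow> \<theta> > 0 \<longrightarrow>
        (\<forall>\<^sub>F n in sequentially. sup_coverable (dual_ball X) (orbit \<alpha> \<Omega> n) \<epsilon> (exp (\<theta> * real n))))"

lemma funpow_in_carrier:
  "\<alpha> \<in> A \<rightarrow> A \<Longrightarrow> x \<in> A \<Longrightarrow> (\<alpha> ^^ k) x \<in> A"
  by (induction k) auto

lemma orbit_subset: "\<alpha> \<in> A \<rightarrow> A \<Longrightarrow> \<Omega> \<subseteq> A \<Longrightarrow> orbit \<alpha> \<Omega> n \<subseteq> A"
  by (auto intro!: funpow_in_carrier)

lemma card_orbit_le: "finite \<Omega> \<Longrightarrow> card (orbit \<alpha> \<Omega> n) \<le> n * card \<Omega>"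
proof -
  assume fin: "finite \<Omega>"
  have "card (orbit \<alpha> \<Omega> n) \<le> (\<Sum>k<n. card ((\<alpha> ^^ k) ` \<Omega>))" by (rule card_UN_le) simp
  also have "\<dots> \<le> (\<Sum>k<n. card \<Omega>)" by (intro sum_mono card_image_le fin)
  finally show ?thesis by simp
qed

lemma isometric_mapD:
  assumes "isometric_map X E f"
  shows "f \<in> carrier X \<rightarrow> carrier E" "linear_map X E f" "x \<in> carrier X \<Longrightarrow> nrm E (f x) = nrm X x"
  using assms unfolding isometric_map_def linear_map_def by auto

lemma isometric_funpow:
  assumes "isometric_map X X \<alpha>"
  shows "isometric_map X X (\<alpha> ^^ k)"
proof (induction k)
  case 0
  show ?case by (simp add: isometric_map_def linear_map_def)
next
  case (Suc k)
  have "nrm X (\<alpha> ((\<alpha> ^^ k) x)) = nrm X x" if "x \<in> carrier X" for x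
  proof -
    have "(\<alpha> ^^ k) x \<in> carrier X" using isometric_mapD(1)[OF Suc] that by auto
    then show ?thesis using isometric_mapD(3)[OF assms] isometric_mapD(3)[OF Suc that] by simp
  qed
  then show ?case
    using linear_map_comp[OF isometric_mapD(2)[OF Suc] isometric_mapD(2)[OF assms]]
    by (simp add: isometric_map_def o_def)
qed

lemma bounded_orbits:
  assumes X: "complex_normed_space X" and \<alpha>: "isometric_map X X \<alpha>"
    and \<Omega>: "finite \<Omega>" "\<Omega> \<subseteq> carrier X"
  obtains R :: real where "R > 0" "\<And>n p. p \<in> orbit \<alpha> \<Omega> n \<Longrightarrow> nrm X p \<le> R"
proof
  interpret X: complex_normed_space X by fact
  have nonneg: "0 \<le> nrm X x" if "x \<in> \<Omega>" for x using that \<Omega> by auto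
  show "1 + (\<Sum>x\<in>\<Omega>. nrm X x) > 0"
    using sum_nonneg[of \<Omega> "nrm X"] nonneg by (simp add: add_pos_nonneg)
  fix n p assume "p \<in> orbit \<alpha> \<Omega> n"
  then obtain k x where x: "x \<in> \<Omega>" "p = (\<alpha> ^^ k) x" by auto
  have "nrm X p = nrm X x"
    using isometric_mapD(3)[OF isometric_funpow[OF \<alpha>]] x \<Omega> by auto
  also have "\<dots> \<le> (\<Sum>x\<in>\<Omega>. nrm X x)"
    using x \<Omega> nonneg by (intro member_le_sum) auto
  finally show "nrm X p \<le> 1 + (\<Sum>x\<in>\<Omega>. nrm X x)" by simp
qed

text \<open>
  The typical \<open>T\<close> is the composition with a map that sends \<open>P\<close> onto \<open>Q\<close>.
\<close>

lemma sup_coverable_pullback: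
  assumes cov: "sup_coverable F P \<epsilon> N" and T: "\<And>g. g \<in> G \<Longrightarrow> T g \<in> F"
    and pts: "\<And>q. q \<in> Q \<Longrightarrow> \<exists>p\<in>P. \<forall>g\<in>G. g q = T g p" and N: "N \<le> N'"
  shows "sup_coverable G Q \<epsilon> N'"
proof -
  obtain L :: "_ \<Rightarrow> nat" where L: "finite (L ` F)" "card (L ` F) \<le> N"
    and close: "\<And>f g p. f \<in> F \<Longrightarrow> g \<in> F \<Longrightarrow> L f = L g \<Longrightarrow> p \<in> P \<Longrightarrow> cmod (f p - g p) \<le> \<epsilon>"
    by (rule sup_coverableE[OF cov]) (rule that)
  show ?thesis
  proof (rule sup_coverableI[where L = "\<lambda>g. L (T g)", OF L(1)])
    show "real (card (L ` F)) \<le> N'" using L(2) N by linarith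
    fix f g q assume fg: "f \<in> G" "g \<in> G" "L (T f) = L (T g)" "q \<in> Q"
    then obtain p where "p \<in> P" "f q = T f p" "g q = T g p" using pts by blast
    then show "cmod (f q - g q) \<le> \<epsilon>" using close T fg by simp
  qed (use T in auto)
qed

lemma sup_coverable_mono:
  "sup_coverable F P \<epsilon> N \<Longrightarrow> N \<le> N' \<Longrightarrow> sup_coverable F P \<epsilon> N'"
  by (rule sup_coverable_pullback[where T = "\<lambda>g. g"]) auto

text \<open>
  One third of the rate \<open>\<theta>\<close> pays for each of the three factors \<open>4\<^sup>m\<close>,
  \<open>d\<^sup>m\<close> and the exponential.  The numbers \<open>m + 1\<close> and \<open>c + 1\<close> keep the
  denominators positive.
\<close>

lemma eventually_count_le_exp:
  fixes \<theta> :: real and m c :: nat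
  assumes \<theta>: "\<theta> > 0"
  shows "\<forall>\<^sub>F n in sequentially. \<forall>d k. real d \<le> exp (\<theta> / (3 * (m + 1)) * n) \<longrightarrow> k \<le> n * c \<longrightarrow>
    (4 * real d) ^ m * exp (\<theta> / (3 * (c + 1)) * real k) \<le> exp (\<theta> * n)"
  using eventually_ge_at_top[of "nat \<lceil>3 * m * ln 4 / \<theta>\<rceil>"]
proof eventually_elim
  case (elim n)
  show ?case
  proof (intro allI impI)
    fix d k :: nat assume d: "real d \<le> exp (\<theta> / (3 * (m + 1)) * n)" and k: "k \<le> n * c"
    have "3 * m * ln 4 / \<theta> \<le> n" using elim by linarith
    then have "m * ln 4 \<le> \<theta> / 3 * n" using \<theta> by (simp add: field_simps)
    then have "exp (m * ln 4) \<le> exp (\<theta> / 3 * n)" by simp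
    then have four: "4 ^ m \<le> exp (\<theta> / 3 * n)" by (simp add: exp_of_nat_mult)
    have "real d ^ m \<le> exp (\<theta> / (3 * (m + 1)) * n) ^ m" by (rule power_mono[OF d]) simp
    also have "\<dots> = exp (\<theta> / 3 * n * (m / (m + 1)))"
      by (simp add: exp_of_nat_mult[symmetric] field_simps)
    also have "\<dots> \<le> exp (\<theta> / 3 * n)"
      using \<theta> by (simp add: mult_left_le field_simps)
    finally have dm: "real d ^ m \<le> exp (\<theta> / 3 * n)" .
    have "real k \<le> n * (c + 1)" using k by (simp flip: of_nat_mult of_nat_add)
    then have "\<theta> / (3 * (c + 1)) * k \<le> \<theta> / (3 * (c + 1)) * (n * (c + 1))"
      using \<theta> by (intro mult_left_mono) auto
    also have "\<dots> = \<theta> / 3 * n" by (simp add: field_simps)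
    finally have ek: "exp (\<theta> / (3 * (c + 1)) * k) \<le> exp (\<theta> / 3 * n)" by simp
    have "(4 * real d) ^ m * exp (\<theta> / (3 * (c + 1)) * k) = 4 ^ m * real d ^ m * exp (\<theta> / (3 * (c + 1)) * k)"
      by (simp add: power_mult_distrib)
    also have "\<dots> \<le> exp (\<theta> / 3 * n) * exp (\<theta> / 3 * n) * exp (\<theta> / 3 * n)"
      using four dm ek by (intro mult_mono) auto
    also have "\<dots> = exp (\<theta> * n)" by (simp add: exp_add[symmetric])
    finally show "(4 * real d) ^ m * exp (\<theta> / (3 * (c + 1)) * k) \<le> exp (\<theta> * n)" .
  qed
qed

lemma factorable_imp_coverable:
  fixes X :: "'a normed_space" and E :: "'b normed_space"
  assumes X: "complex_normed_space X" and E: "complex_normed_space E"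
    and \<iota>: "isometric_map X E \<iota>" and \<alpha>: "isometric_map X X \<alpha>"
    and fac: "subexp_factorable X E \<iota> \<alpha>"
  shows "subexp_coverable X \<alpha>"
  unfolding subexp_coverable_def
proof (intro allI impI)
  fix \<Omega> and \<epsilon> \<theta> :: real
  assume \<Omega>: "finite \<Omega>" "\<Omega> \<subseteq> carrier X" and \<epsilon>: "\<epsilon> > 0" and \<theta>: "\<theta> > 0"
  obtain R :: real where R: "R > 0" and nrm_R: "\<And>n p. p \<in> orbit \<alpha> \<Omega> n \<Longrightarrow> nrm X p \<le> R"
    using bounded_orbits[OF X \<alpha> \<Omega>] by metis
  define c where "c = card \<Omega>"
  have \<theta>c: "\<theta> / (3 * (c + 1)) > 0" using \<theta> by (intro divide_pos_pos) auto
  show "\<forall>\<^sub>F n in sequentially. sup_coverable (dual_ball X) (orbit \<alpha> \<Omega> n) \<epsilon> (exp (\<theta> * real n))"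
  proof (rule dual_ball_sup_coverable[OF R \<epsilon> \<theta>c, where 'a='a and 'b='b])
    fix \<delta> :: real and m :: nat
    assume \<delta>: "\<delta> > 0"
      and cov: "\<And>(X :: 'a normed_space) (E :: 'b normed_space) \<iota> P \<phi> \<psi> d.
        complex_normed_space X \<Longrightarrow> complex_normed_space E \<Longrightarrow> isometric_map X E \<iota> \<Longrightarrow>
        finite P \<Longrightarrow> P \<subseteq> carrier X \<Longrightarrow> (\<And>p. p \<in> P \<Longrightarrow> nrm X p \<le> R) \<Longrightarrow>
        (\<phi>, \<psi>, d) \<in> CA X E \<iota> P \<delta> \<Longrightarrow>
        sup_coverable (dual_ball X) P \<epsilon> ((4 * real d) ^ m * exp (\<theta> / (3 * (c + 1)) * card P))"
    have "\<theta> / (3 * (m + 1)) > 0" using \<theta> by (intro divide_pos_pos) auto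
    then have "\<forall>\<^sub>F n in sequentially. \<exists>\<phi> \<psi> d. (\<phi>, \<psi>, d) \<in> CA X E \<iota> (orbit \<alpha> \<Omega> n) \<delta> \<and>
        real d \<le> exp (\<theta> / (3 * (m + 1)) * real n)"
      using fac \<Omega> \<delta> unfolding subexp_factorable_def by blast
    then show ?thesis
      using eventually_count_le_exp[OF \<theta>, of m c]
    proof eventually_elim
      case (elim n)
      then obtain \<phi> \<psi> d where CA: "(\<phi>, \<psi>, d) \<in> CA X E \<iota> (orbit \<alpha> \<Omega> n) \<delta>"
        and d: "real d \<le> exp (\<theta> / (3 * (m + 1)) * real n)" by blast
      have "sup_coverable (dual_ball X) (orbit \<alpha> \<Omega> n) \<epsilon>
          ((4 * real d) ^ m * exp (\<theta> / (3 * (c + 1)) * card (orbit \<alpha> \<Omega> n)))"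
        using \<Omega> orbit_subset[OF isometric_mapD(1)[OF \<alpha>] \<Omega>(2)] nrm_R
        by (intro cov[OF X E \<iota> _ _ _ CA]) auto
      then show ?case
      proof (rule sup_coverable_mono)
        show "(4 * real d) ^ m * exp (\<theta> / (3 * (c + 1)) * card (orbit \<alpha> \<Omega> n)) \<le> exp (\<theta> * n)"
          using elim(2) d card_orbit_le[OF \<Omega>(1), of \<alpha> n] unfolding c_def by blast
      qed
    qed
  qed
qed

lemma coverable_imp_factorable:
  assumes \<iota>: "CA_embedding X E \<iota>" and \<alpha>: "\<alpha> \<in> carrier X \<rightarrow> carrier X"
    and cov: "subexp_coverable X \<alpha>"
  shows "subexp_factorable X E \<iota> \<alpha>"
  unfolding subexp_factorable_def
proof (intro allI impI)
  fix \<Omega> and \<delta> \<theta> :: real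
  assume \<Omega>: "finite \<Omega>" "\<Omega> \<subseteq> carrier X" and \<delta>: "\<delta> > 0" and \<theta>: "\<theta> > 0"
  have "\<forall>\<^sub>F n in sequentially. sup_coverable (dual_ball X) (orbit \<alpha> \<Omega> n) (\<delta> / 2) (exp (\<theta> * real n))"
    using cov \<Omega> \<delta> \<theta> unfolding subexp_coverable_def by simp
  then show "\<forall>\<^sub>F n in sequentially. \<exists>\<phi> \<psi> d.
      (\<phi>, \<psi>, d) \<in> CA X E \<iota> (orbit \<alpha> \<Omega> n) \<delta> \<and> real d \<le> exp (\<theta> * real n)"
  proof eventually_elim
    case (elim n)
    then show ?case
      using \<Omega> \<delta> orbit_subset[OF \<alpha> \<Omega>(2)] by (intro CA_of_sup_coverable[OF \<iota>]) auto
  qed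
qed

lemma rc_attained:
  assumes "CA X E \<iota> P \<delta> \<noteq> {}"
  shows "\<exists>\<phi> \<psi>. (\<phi>, \<psi>, rc X E \<iota> P \<delta>) \<in> CA X E \<iota> P \<delta>"
proof -
  let ?D = "{d. \<exists>\<phi> \<psi>. (\<phi>, \<psi>, d) \<in> CA X E \<iota> P \<delta>}"
  have "?D \<noteq> {}" using assms by auto
  then have "Inf ?D \<in> ?D" by (rule Inf_nat_def1)
  then show ?thesis unfolding rc_def by blast
qed

lemma rc_le: "(\<phi>, \<psi>, d) \<in> CA X E \<iota> P \<delta> \<Longrightarrow> rc X E \<iota> P \<delta> \<le> d"
  unfolding rc_def by (rule cInf_lower) auto

text \<open>
  The minimum \<open>rc\<close> is attained and at least 1, so \<open>hc\<close> is a supremum of limits superior of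
  nonnegative numbers.
\<close>

lemma hc_eq_0_iff_factorable:
  assumes \<iota>: "CA_embedding X E \<iota>" and \<alpha>: "\<alpha> \<in> carrier X \<rightarrow> carrier X"
  shows "hc X E \<iota> \<alpha> = 0 \<longleftrightarrow> subexp_factorable X E \<iota> \<alpha>"
proof -
  let ?rc = "\<lambda>\<Omega> \<delta> n. real (rc X E \<iota> (orbit \<alpha> \<Omega> n) \<delta>)"
  let ?W = "{\<Omega>. finite \<Omega> \<and> \<Omega> \<subseteq> carrier X}"
  have CA: "CA X E \<iota> (orbit \<alpha> \<Omega> n) \<delta> \<noteq> {}" if "\<Omega> \<in> ?W" "\<delta> > 0" for \<Omega> \<delta> n
    using \<iota> that orbit_subset[OF \<alpha>, of \<Omega> n] unfolding CA_embedding_def by auto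
  have rc1: "?rc \<Omega> \<delta> n \<ge> 1" if \<Omega>: "\<Omega> \<in> ?W" and \<delta>: "\<delta> > 0" for \<Omega> \<delta> n
    using rc_attained[OF CA[OF \<Omega> \<delta>]] by (auto simp: CA_def Suc_le_eq)
  have scale_nonneg: "0 \<le> hc_scale X E \<iota> \<alpha> \<Omega> \<delta>" if "\<Omega> \<in> ?W" "\<delta> > 0" for \<Omega> \<delta>
    unfolding hc_scale_def
    by (rule le_Limsup) (use rc1[OF that] in \<open>auto intro!: always_eventually\<close>)
  have "0 \<le> hc_set X E \<iota> \<alpha> \<Omega>" if "\<Omega> \<in> ?W" for \<Omega>
    unfolding hc_set_def by (rule SUP_upper2[of 1]) (use scale_nonneg[OF that] in auto)
  then have "0 \<le> hc X E \<iota> \<alpha>"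
    unfolding hc_def by (intro SUP_upper2[of "{}"]) auto
  then have "hc X E \<iota> \<alpha> = 0 \<longleftrightarrow> hc X E \<iota> \<alpha> \<le> 0" by (auto intro: antisym)
  also have "\<dots> \<longleftrightarrow> (\<forall>\<Omega>\<in>?W. \<forall>\<delta>>0. hc_scale X E \<iota> \<alpha> \<Omega> \<delta> \<le> 0)"
    unfolding hc_def hc_set_def by (auto simp: SUP_le_iff)
  also have "\<dots> \<longleftrightarrow> (\<forall>\<Omega>\<in>?W. \<forall>\<delta>>0. \<forall>\<theta>>0. \<forall>\<^sub>F n in sequentially. \<exists>\<phi> \<psi> d.
      (\<phi>, \<psi>, d) \<in> CA X E \<iota> (orbit \<alpha> \<Omega> n) \<delta> \<and> real d \<le> exp (\<theta> * real n))"
  proof (intro ball_cong all_cong refl)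
    fix \<Omega> and \<delta> :: real assume \<Omega>: "\<Omega> \<in> ?W" and \<delta>: "\<delta> > 0"
    let ?u = "\<lambda>n. 1 / real n * ln (?rc \<Omega> \<delta> n)"
    let ?A = "\<lambda>\<theta> n. \<exists>\<phi> \<psi> d. (\<phi>, \<psi>, d) \<in> CA X E \<iota> (orbit \<alpha> \<Omega> n) \<delta> \<and> real d \<le> exp (\<theta> * real n)"
    have A_iff: "?A \<theta> n \<longleftrightarrow> ?rc \<Omega> \<delta> n \<le> exp (\<theta> * real n)" for \<theta> n
    proof
      assume "?A \<theta> n"
      then obtain \<phi> \<psi> d where "(\<phi>, \<psi>, d) \<in> CA X E \<iota> (orbit \<alpha> \<Omega> n) \<delta>" and d: "real d \<le> exp (\<theta> * real n)"
        by blast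
      from rc_le[OF this(1)] d show "?rc \<Omega> \<delta> n \<le> exp (\<theta> * real n)" by linarith
    next
      assume "?rc \<Omega> \<delta> n \<le> exp (\<theta> * real n)"
      then show "?A \<theta> n" using rc_attained[OF CA[OF \<Omega> \<delta>, of n]] by blast
    qed
    have u_iff: "?u n \<le> \<theta> \<longleftrightarrow> ?rc \<Omega> \<delta> n \<le> exp (\<theta> * real n)" if "n > 0" for n \<theta>
    proof -
      have "?u n \<le> \<theta> \<longleftrightarrow> ln (?rc \<Omega> \<delta> n) \<le> \<theta> * real n" using that by (simp add: field_simps)
      also have "\<dots> \<longleftrightarrow> ?rc \<Omega> \<delta> n \<le> exp (\<theta> * real n)"
        using rc1[OF \<Omega> \<delta>, of n] by (subst exp_le_cancel_iff[symmetric]) (simp add: exp_ln)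
      finally show ?thesis .
    qed
    have "hc_scale X E \<iota> \<alpha> \<Omega> \<delta> \<le> 0 \<longleftrightarrow> (\<forall>y>0. \<forall>\<^sub>F n in sequentially. ereal (?u n) < y)"
      unfolding hc_scale_def by (rule Limsup_le_iff)
    also have "\<dots> \<longleftrightarrow> (\<forall>\<theta>>0. \<forall>\<^sub>F n in sequentially. ?A \<theta> n)"
    proof (intro iffI allI impI)
      fix \<theta> :: real assume H: "\<forall>y>0. \<forall>\<^sub>F n in sequentially. ereal (?u n) < y" and "\<theta> > 0"
      then have "0 < ereal \<theta>" by simp
      with H have "\<forall>\<^sub>F n in sequentially. ereal (?u n) < ereal \<theta>" by blast
      then show "\<forall>\<^sub>F n in sequentially. ?A \<theta> n"
        using eventually_gt_at_top[of 0]
      proof eventually_elim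
        case (elim n)
        then have "?u n \<le> \<theta>" by simp
        then show ?case using u_iff[OF elim(2)] A_iff by blast
      qed
    next
      fix y :: ereal assume H: "\<forall>\<theta>>0. \<forall>\<^sub>F n in sequentially. ?A \<theta> n" and "y > 0"
      then obtain \<theta> :: real where \<theta>: "0 < ereal \<theta>" "ereal \<theta> < y" using ereal_dense2 by blast
      then have "\<forall>\<^sub>F n in sequentially. ?A \<theta> n" using H by simp
      then show "\<forall>\<^sub>F n in sequentially. ereal (?u n) < y"
        using eventually_gt_at_top[of 0]
      proof eventually_elim
        case (elim n)
        then have "?u n \<le> \<theta>" using u_iff[OF elim(2)] A_iff by blast
        then show ?case using \<theta>(2) by (meson ereal_less_eq(3) le_less_trans)
      qed
    qed
    finally show "hc_scale X E \<iota> \<alpha> \<Omega> \<delta> \<le> 0 \<longleftrightarrow> (\<forall>\<theta>>0. \<forall>\<^sub>F n in sequentially. ?A \<theta> n)" .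
  qed
  also have "\<dots> \<longleftrightarrow> subexp_factorable X E \<iota> \<alpha>"
    unfolding subexp_factorable_def by blast
  finally show ?thesis .
qed


section \<open>Subspaces\<close>

lemma subspace_simps [simp]:
  "carrier (subspace_of X Y) = Y" "nrm (subspace_of X Y) = nrm X"
  "add (subspace_of X Y) = add X" "smult (subspace_of X Y) = smult X"
  "\<zero>\<^bsub>subspace_of X Y\<^esub> = \<zero>\<^bsub>X\<^esub>"
  by (simp_all add: subspace_of_def)

lemma complex_normed_space_subspace:
  assumes X: "complex_normed_space X" and Y: "submodule Y complex_field X"
  shows "complex_normed_space (subspace_of X Y)"
proof -
  interpret X: complex_normed_space X by fact
  have "module complex_field (subspace_of X Y)"
    unfolding subspace_of_def by (rule submodule.submodule_is_module[OF Y X.module_axioms])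
  moreover have "Y \<subseteq> carrier X" using X.submoduleE(1)[OF Y] .
  ultimately show ?thesis
    by (intro complex_normed_space.intro complex_normed_space_axioms.intro)
      (auto simp: X.nrm_eq_0_iff X.nrm_triangle X.nrm_smult subset_iff)
qed

lemma isometric_map_restrict_domain:
  assumes "isometric_map X E f" "Y \<subseteq> carrier X"
  shows "isometric_map (subspace_of X Y) E f"
  using assms unfolding isometric_map_def linear_map_def by (auto simp: subset_iff)

lemma funpow_restrict:
  "\<alpha> \<in> A \<rightarrow> A \<Longrightarrow> x \<in> A \<Longrightarrow> (restrict \<alpha> A ^^ k) x = (\<alpha> ^^ k) x"
  by (induction k) (auto simp: funpow_in_carrier)

lemma orbit_restrict:
  assumes "\<alpha> \<in> A \<rightarrow> A" "\<Omega> \<subseteq> A"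
  shows "orbit (restrict \<alpha> A) \<Omega> n = orbit \<alpha> \<Omega> n"
proof -
  have "(restrict \<alpha> A ^^ k) ` \<Omega> = (\<alpha> ^^ k) ` \<Omega>" for k
    by (intro image_cong refl funpow_restrict[OF assms(1)]) (use assms(2) in auto)
  then show ?thesis by simp
qed

lemma CA_subspace:
  assumes "Y \<subseteq> carrier X" "(\<phi>, \<psi>, d) \<in> CA X E \<iota> P \<delta>"
  shows "(\<phi>, \<psi>, d) \<in> CA (subspace_of X Y) E \<iota> P \<delta>"
  using assms unfolding CA_def contractive_map_def linear_map_def by (auto simp: subset_iff)

text \<open>
  The target \<open>E\<close> is kept: \<open>\<phi>\<close> is restricted to \<open>Y\<close>, and the factorizations obtained
  are those of the restriction of \<open>\<iota>\<close>, which is still isometric.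
\<close>

lemma factorable_subspace:
  assumes Y: "Y \<subseteq> carrier X" and \<alpha>: "\<alpha> \<in> Y \<rightarrow> Y" and fac: "subexp_factorable X E \<iota> \<alpha>"
  shows "subexp_factorable (subspace_of X Y) E \<iota> (restrict \<alpha> Y)"
  unfolding subexp_factorable_def
proof (intro allI impI)
  fix \<Omega> and \<delta> \<theta> :: real
  assume \<Omega>: "finite \<Omega>" "\<Omega> \<subseteq> carrier (subspace_of X Y)" and pos: "\<delta> > 0" "\<theta> > 0"
  then have "\<Omega> \<subseteq> Y" by simp
  with Y have "\<Omega> \<subseteq> carrier X" by blast
  with fac \<Omega> pos have "\<forall>\<^sub>F n in sequentially. \<exists>\<phi> \<psi> d.
      (\<phi>, \<psi>, d) \<in> CA X E \<iota> (orbit \<alpha> \<Omega> n) \<delta> \<and> real d \<le> exp (\<theta> * real n)"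
    unfolding subexp_factorable_def by blast
  then show "\<forall>\<^sub>F n in sequentially. \<exists>\<phi> \<psi> d.
      (\<phi>, \<psi>, d) \<in> CA (subspace_of X Y) E \<iota> (orbit (restrict \<alpha> Y) \<Omega> n) \<delta> \<and>
      real d \<le> exp (\<theta> * real n)"
    unfolding orbit_restrict[OF \<alpha> \<open>\<Omega> \<subseteq> Y\<close>]
  proof eventually_elim
    case (elim n)
    then show ?case using CA_subspace[OF Y] by blast
  qed
qed


section \<open>Quotients\<close>

context
  fixes X :: "'a normed_space" and Y :: "'a set"
  assumes X: "complex_normed_space X" and Y: "submodule Y complex_field X"
begin

interpretation X: complex_normed_space X by (rule X)

lemma submodule_subset: "Y \<subseteq> carrier X" and submodule_smult: "x \<in> Y \<Longrightarrow> c \<odot>\<^bsub>X\<^esub> x \<in> Y"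
  using X.submoduleE[OF Y] by auto

lemma submodule_abelian_subgroup: "abelian_subgroup Y X"
  using Y by (intro abelian_subgroupI3 additive_subgroupI) (auto simp: submodule_def X.M.abelian_group_axioms)

interpretation Y: abelian_subgroup Y X by (rule submodule_abelian_subgroup)

lemma quotient_proj_eq: "quotient_proj X Y x = (\<lambda>y. y \<oplus>\<^bsub>X\<^esub> x) ` Y"
  by (auto simp: quotient_proj_def a_r_coset_def')

lemma quotient_proj_add_Y:
  assumes "y \<in> Y" "x \<in> carrier X"
  shows "quotient_proj X Y (y \<oplus>\<^bsub>X\<^esub> x) = quotient_proj X Y x"
proof -
  have "y \<oplus>\<^bsub>X\<^esub> x \<in> quotient_proj X Y x" using assms by (auto simp: quotient_proj_eq)
  then show ?thesis
    using X.M.a_repr_independence[of "y \<oplus>\<^bsub>X\<^esub> x" Y x] assms Y.a_subgroup by (simp add: quotient_proj_def)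
qed

lemma linear_map_quotient_proj: "linear_map X (quotient_space X Y) (quotient_proj X Y)"
proof -
  have "quotient_proj X Y (c \<odot>\<^bsub>X\<^esub> x) = c \<odot>\<^bsub>quotient_space X Y\<^esub> quotient_proj X Y x"
    if x: "x \<in> carrier X" for c x
  proof -
    have "quotient_proj X Y (c \<odot>\<^bsub>X\<^esub> (y \<oplus>\<^bsub>X\<^esub> x)) = quotient_proj X Y (c \<odot>\<^bsub>X\<^esub> x)"
      if y: "y \<in> Y" for y
      using quotient_proj_add_Y[OF submodule_smult[OF y, of c], of "c \<odot>\<^bsub>X\<^esub> x"] x y submodule_subset
      by (simp add: X.smult_r_distr subset_iff)
    moreover have "Y \<noteq> {}" using X.submoduleE(2)[OF Y] .
    ultimately have "(\<Union>x'\<in>quotient_proj X Y x. quotient_proj X Y (c \<odot>\<^bsub>X\<^esub> x'))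
        = quotient_proj X Y (c \<odot>\<^bsub>X\<^esub> x)"
      by (simp add: quotient_proj_eq[of x])
    then show ?thesis by (simp add: quotient_space_def quotient_proj_def)
  qed
  moreover have "quotient_proj X Y (x \<oplus>\<^bsub>X\<^esub> y) = quotient_proj X Y x \<oplus>\<^bsub>quotient_space X Y\<^esub> quotient_proj X Y y"
    if "x \<in> carrier X" "y \<in> carrier X" for x y
    using Y.a_rcos_sum[OF that] by (simp add: quotient_space_def quotient_proj_def)
  moreover have "quotient_proj X Y x \<in> carrier (quotient_space X Y)" if "x \<in> carrier X" for x
    using X.M.a_rcosetsI[OF submodule_subset that] by (simp add: quotient_space_def quotient_proj_def)
  ultimately show ?thesis unfolding linear_map_def by auto
qed

lemma quotient_proj_surj:
  assumes "A \<in> carrier (quotient_space X Y)"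
  obtains x where "x \<in> carrier X" "A = quotient_proj X Y x"
  using assms by (auto simp: quotient_space_def A_RCOSETS_def' quotient_proj_def)

lemma nrm_quotient_proj: "nrm (quotient_space X Y) (quotient_proj X Y x) = (INF y\<in>Y. nrm X (y \<oplus>\<^bsub>X\<^esub> x))"
  by (simp add: quotient_space_def quotient_proj_eq image_image)

lemma nrm_quotient_proj_le:
  assumes "x \<in> carrier X" "y \<in> Y"
  shows "nrm (quotient_space X Y) (quotient_proj X Y x) \<le> nrm X (y \<oplus>\<^bsub>X\<^esub> x)"
proof -
  have "bdd_below ((\<lambda>y. nrm X (y \<oplus>\<^bsub>X\<^esub> x)) ` Y)"
  proof (rule bdd_belowI2)
    fix y assume "y \<in> Y"
    then show "0 \<le> nrm X (y \<oplus>\<^bsub>X\<^esub> x)"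
      by (intro X.nrm_nonneg X.M.a_closed subsetD[OF submodule_subset] assms(1))
  qed
  then show ?thesis unfolding nrm_quotient_proj using assms(2) by (rule cINF_lower)
qed

lemma nrm_quotient_proj_greatest:
  "(\<And>y. y \<in> Y \<Longrightarrow> r \<le> nrm X (y \<oplus>\<^bsub>X\<^esub> x)) \<Longrightarrow> r \<le> nrm (quotient_space X Y) (quotient_proj X Y x)"
  unfolding nrm_quotient_proj using X.submoduleE(2)[OF Y] by (intro cINF_greatest) auto

lemma nrm_quotient_proj_nonneg: "x \<in> carrier X \<Longrightarrow> 0 \<le> nrm (quotient_space X Y) (quotient_proj X Y x)"
  using submodule_subset by (intro nrm_quotient_proj_greatest) auto

lemma nrm_quotient_proj_smult_le:
  assumes x: "x \<in> carrier X" and c: "c \<noteq> 0"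
  shows "nrm (quotient_space X Y) (quotient_proj X Y (c \<odot>\<^bsub>X\<^esub> x))
    \<le> cmod c * nrm (quotient_space X Y) (quotient_proj X Y x)"
proof -
  have "nrm (quotient_space X Y) (quotient_proj X Y (c \<odot>\<^bsub>X\<^esub> x)) / cmod c
      \<le> nrm (quotient_space X Y) (quotient_proj X Y x)"
  proof (rule nrm_quotient_proj_greatest)
    fix y assume y: "y \<in> Y"
    have "nrm (quotient_space X Y) (quotient_proj X Y (c \<odot>\<^bsub>X\<^esub> x))
        \<le> nrm X (c \<odot>\<^bsub>X\<^esub> y \<oplus>\<^bsub>X\<^esub> c \<odot>\<^bsub>X\<^esub> x)"
      using x submodule_smult[OF y] by (intro nrm_quotient_proj_le) auto
    also have "\<dots> = cmod c * nrm X (y \<oplus>\<^bsub>X\<^esub> x)"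
      using x y submodule_subset by (subst X.smult_r_distr[symmetric]) (auto simp: X.nrm_smult)
    finally show "nrm (quotient_space X Y) (quotient_proj X Y (c \<odot>\<^bsub>X\<^esub> x)) / cmod c \<le> nrm X (y \<oplus>\<^bsub>X\<^esub> x)"
      using c by (simp add: field_simps)
  qed
  then show ?thesis using c by (simp add: field_simps)
qed

lemma dual_ball_quotient_proj:
  assumes "f \<in> dual_ball (quotient_space X Y)"
  shows "(\<lambda>x. f (quotient_proj X Y x)) \<in> dual_ball X"
proof -
  have Q_carr: "quotient_proj X Y x \<in> carrier (quotient_space X Y)" if "x \<in> carrier X" for x
    using linear_map_quotient_proj that unfolding linear_map_def by auto
  have "linear_functional X (\<lambda>x. f (quotient_proj X Y x))"
    using assms linear_map_quotient_proj Q_carr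
    unfolding dual_ball_def linear_functional_def linear_map_def by auto
  moreover have "cmod (f (quotient_proj X Y x)) \<le> nrm X x" if x: "x \<in> carrier X" for x
  proof -
    have "cmod (f (quotient_proj X Y x)) \<le> nrm (quotient_space X Y) (quotient_proj X Y x)"
      using assms Q_carr[OF x] unfolding dual_ball_def by auto
    also have "\<dots> \<le> nrm X (\<zero>\<^bsub>X\<^esub> \<oplus>\<^bsub>X\<^esub> x)"
      by (rule nrm_quotient_proj_le[OF x]) simp
    finally show ?thesis using x by simp
  qed
  ultimately show ?thesis by (simp add: dual_ball_def)
qed

lemma funpow_quotient_proj:
  assumes \<alpha>: "\<alpha> \<in> carrier X \<rightarrow> carrier X"
    and eq: "\<And>x. x \<in> carrier X \<Longrightarrow> \<alpha>' (quotient_proj X Y x) = quotient_proj X Y (\<alpha> x)" and x: "x \<in> carrier X"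
  shows "(\<alpha>' ^^ k) (quotient_proj X Y x) = quotient_proj X Y ((\<alpha> ^^ k) x)"
  using x by (induction k) (auto simp: eq funpow_in_carrier[OF \<alpha>])

lemma orbit_quotient_proj:
  assumes \<alpha>: "\<alpha> \<in> carrier X \<rightarrow> carrier X"
    and eq: "\<And>x. x \<in> carrier X \<Longrightarrow> \<alpha>' (quotient_proj X Y x) = quotient_proj X Y (\<alpha> x)" and \<Omega>: "\<Omega> \<subseteq> carrier X"
  shows "orbit \<alpha>' (quotient_proj X Y ` \<Omega>) n = quotient_proj X Y ` orbit \<alpha> \<Omega> n"
proof -
  have "(\<alpha>' ^^ k) ` quotient_proj X Y ` \<Omega> = quotient_proj X Y ` (\<alpha> ^^ k) ` \<Omega>" for k
    unfolding image_image by (intro image_cong refl funpow_quotient_proj[OF \<alpha> eq]) (use \<Omega> in auto)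
  then show ?thesis by (simp add: image_UN)
qed

lemma coverable_quotient:
  assumes \<alpha>: "\<alpha> \<in> carrier X \<rightarrow> carrier X"
    and eq: "\<And>x. x \<in> carrier X \<Longrightarrow> \<alpha>' (quotient_proj X Y x) = quotient_proj X Y (\<alpha> x)" and cov: "subexp_coverable X \<alpha>"
  shows "subexp_coverable (quotient_space X Y) \<alpha>'"
  unfolding subexp_coverable_def
proof (intro allI impI)
  fix \<Omega>' and \<epsilon> \<theta> :: real
  assume \<Omega>': "finite \<Omega>'" "\<Omega>' \<subseteq> carrier (quotient_space X Y)" and pos: "\<epsilon> > 0" "\<theta> > 0"
  have "\<Omega>' \<subseteq> quotient_proj X Y ` carrier X" using \<Omega>'(2) quotient_proj_surj by blast
  then obtain \<Omega> where \<Omega>: "\<Omega> \<subseteq> carrier X" "finite \<Omega>" "\<Omega>' = quotient_proj X Y ` \<Omega>"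
    using finite_subset_image[OF \<Omega>'(1)] by blast
  have "\<forall>\<^sub>F n in sequentially. sup_coverable (dual_ball X) (orbit \<alpha> \<Omega> n) \<epsilon> (exp (\<theta> * real n))"
    using cov \<Omega> pos unfolding subexp_coverable_def by blast
  then show "\<forall>\<^sub>F n in sequentially.
      sup_coverable (dual_ball (quotient_space X Y)) (orbit \<alpha>' \<Omega>' n) \<epsilon> (exp (\<theta> * real n))"
  proof eventually_elim
    case (elim n)
    show ?case
    proof (rule sup_coverable_pullback[OF elim, where T = "\<lambda>f x. f (quotient_proj X Y x)"])
      show "(\<lambda>x. f (quotient_proj X Y x)) \<in> dual_ball X" if "f \<in> dual_ball (quotient_space X Y)" for f
        by (rule dual_ball_quotient_proj[OF that])
      fix q assume "q \<in> orbit \<alpha>' \<Omega>' n"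
      moreover have "orbit \<alpha>' \<Omega>' n = quotient_proj X Y ` orbit \<alpha> \<Omega> n"
        unfolding \<Omega>(3) by (rule orbit_quotient_proj[OF \<alpha> eq \<Omega>(1)])
      ultimately have "q \<in> quotient_proj X Y ` orbit \<alpha> \<Omega> n" by (simp only:)
      then show "\<exists>p\<in>orbit \<alpha> \<Omega> n. \<forall>f\<in>dual_ball (quotient_space X Y). f q = f (quotient_proj X Y p)" by blast
    qed simp
  qed
qed

text \<open>
  The quotient seminorm of a linear combination is Lipschitz in the coefficients; this is what allows them to be
  taken from a finite net.
\<close>

lemma nrm_quotient_lincomb_le:
  assumes P: "finite P" "P \<subseteq> carrier X" and close: "\<And>p. p \<in> P \<Longrightarrow> cmod (b p - a p) \<le> \<kappa>"
  shows "nrm (quotient_space X Y) (quotient_proj X Y (lincomb X b P))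
    \<le> nrm (quotient_space X Y) (quotient_proj X Y (lincomb X a P)) + \<kappa> * (\<Sum>p\<in>P. nrm X p)"
proof -
  let ?a = "lincomb X a P" and ?b = "lincomb X b P" and ?d = "lincomb X (\<lambda>p. b p - a p) P"
  have carr: "?a \<in> carrier X" "?b \<in> carrier X" "?d \<in> carrier X" using P(2) by auto
  have b: "?b = ?a \<oplus>\<^bsub>X\<^esub> ?d" using X.lincomb_add[OF P, of a "\<lambda>p. b p - a p"] by simp
  have "nrm X ?d \<le> (\<Sum>p\<in>P. cmod (b p - a p) * nrm X p)" by (rule X.nrm_lincomb_le[OF P])
  also have "\<dots> \<le> (\<Sum>p\<in>P. \<kappa> * nrm X p)"
    using P(2) close by (intro sum_mono mult_right_mono) auto
  finally have d: "nrm X ?d \<le> \<kappa> * (\<Sum>p\<in>P. nrm X p)" by (simp add: sum_distrib_left)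
  have "nrm (quotient_space X Y) (quotient_proj X Y ?b) - \<kappa> * (\<Sum>p\<in>P. nrm X p) \<le> nrm (quotient_space X Y) (quotient_proj X Y ?a)"
  proof (rule nrm_quotient_proj_greatest)
    fix y assume y: "y \<in> Y"
    then have yX: "y \<in> carrier X" using submodule_subset by auto
    have "nrm (quotient_space X Y) (quotient_proj X Y ?b) \<le> nrm X (y \<oplus>\<^bsub>X\<^esub> ?b)"
      by (rule nrm_quotient_proj_le[OF carr(2) y])
    also have "y \<oplus>\<^bsub>X\<^esub> ?b = (y \<oplus>\<^bsub>X\<^esub> ?a) \<oplus>\<^bsub>X\<^esub> ?d"
      using carr yX by (simp add: b X.M.a_assoc)
    also have "nrm X \<dots> \<le> nrm X (y \<oplus>\<^bsub>X\<^esub> ?a) + nrm X ?d"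
      using carr yX by (intro X.nrm_triangle) auto
    finally show "nrm (quotient_space X Y) (quotient_proj X Y ?b) - \<kappa> * (\<Sum>p\<in>P. nrm X p) \<le> nrm X (y \<oplus>\<^bsub>X\<^esub> ?a)"
      using d by linarith
  qed
  then show ?thesis by linarith
qed


end


section \<open>Extensions\<close>

text \<open>
  The bound 2 on the norm is that for the difference of two functionals in the dual ball.
\<close>

definition small_on :: "'a normed_space \<Rightarrow> 'a set \<Rightarrow> real \<Rightarrow> ('a \<Rightarrow> complex) set" where
  "small_on X Z \<rho> = {g. linear_functional X g \<and> (\<forall>x\<in>carrier X. cmod (g x) \<le> 2 * nrm X x) \<and>
     (\<forall>y\<in>Z. cmod (g y) \<le> \<rho>)}"

text \<open>
  If \<open>g\<close> vanished on \<open>Y\<close>, the inequality would hold with \<open>\<sigma> = 0\<close>: replace the linear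
  combination by the element of smallest norm in its coset.  Up to \<open>\<sigma>\<close>, it suffices that \<open>g\<close> is
  small at the elements of \<open>Y\<close> by which such replacements are made for the coefficients in a finite net of
  the polydisc, and \<open>Z\<close> consists of these.
\<close>

lemma small_on_Y_almost_annihilates:
  assumes X: "complex_normed_space X" and Y: "submodule Y complex_field X"
    and P: "finite P" "P \<subseteq> carrier X" and \<sigma>: "\<sigma> > 0"
  shows "\<exists>Z \<rho>. finite Z \<and> Z \<subseteq> Y \<and> \<rho> > 0 \<and> (\<forall>g\<in>small_on X Z \<rho>. \<forall>a.
    cmod (\<Sum>p\<in>P. a p * g p)
      \<le> 2 * nrm (quotient_space X Y) (quotient_proj X Y (lincomb X a P)) + \<sigma> * (\<Sum>p\<in>P. cmod (a p)))"
proof -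
  interpret X: complex_normed_space X by (rule X)
  let ?n = "\<lambda>a. nrm (quotient_space X Y) (quotient_proj X Y (lincomb X a P))"
  define R where "R = (\<Sum>p\<in>P. nrm X p)"
  have R: "R \<ge> 0" unfolding R_def using P(2) by (intro sum_nonneg) auto
  \<comment> \<open>Passing from \<open>a\<close> to the net changes either side by \<open>2R\<kappa>\<close>; the element of \<open>Y\<close> costs
    \<open>2\<kappa>\<close> by its choice and \<open>\<kappa>\<close> by the size of \<open>g\<close> there.\<close>
  define \<kappa> where "\<kappa> = \<sigma> / (4 * R + 3)"
  have "(4 * R + 3) * \<kappa> = \<sigma>" using R by (simp add: \<kappa>_def)
  moreover have "\<kappa> > 0" unfolding \<kappa>_def using R \<sigma> by (intro divide_pos_pos) auto
  ultimately have \<kappa>: "\<kappa> > 0" "4 * R * \<kappa> + 3 * \<kappa> = \<sigma>" by (simp_all add: distrib_right)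
  have "\<exists>K. finite K \<and> cball (0::complex) 1 \<subseteq> (\<Union>z\<in>K. ball z \<kappa>)"
    using compact_cball[of "0::complex" 1] \<kappa>(1) unfolding compact_eq_totally_bounded by meson
  then obtain K where K: "finite K" "cball (0::complex) 1 \<subseteq> (\<Union>z\<in>K. ball z \<kappa>)" by blast
  define near where "near v = (SOME z. z \<in> K \<and> v \<in> ball z \<kappa>)" for v
  have near: "near v \<in> K \<and> v \<in> ball (near v) \<kappa>" if "cmod v \<le> 1" for v
  proof -
    have "v \<in> (\<Union>z\<in>K. ball z \<kappa>)" by (rule subsetD[OF K(2)]) (use that in simp)
    then have "\<exists>z. z \<in> K \<and> v \<in> ball z \<kappa>" by blast
    then show ?thesis unfolding near_def by (rule someI_ex)
  qed
  define net where "net = P \<rightarrow>\<^sub>E K"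
  have "\<exists>y\<in>Y. nrm X (y \<oplus>\<^bsub>X\<^esub> lincomb X b P) < ?n b + \<kappa>" for b
  proof (rule ccontr)
    assume "\<not> ?thesis"
    then have "?n b + \<kappa> \<le> ?n b" by (intro nrm_quotient_proj_greatest[OF X Y]) (auto simp: not_less)
    then show False using \<kappa>(1) by simp
  qed
  then obtain y where y: "\<And>b. y b \<in> Y" "\<And>b. nrm X (y b \<oplus>\<^bsub>X\<^esub> lincomb X b P) < ?n b + \<kappa>"
    by metis
  have unit: "cmod (\<Sum>p\<in>P. a p * g p) \<le> 2 * ?n a + \<sigma>"
    if g: "g \<in> small_on X (y ` net) \<kappa>" and a: "\<And>p. p \<in> P \<Longrightarrow> cmod (a p) \<le> 1" for g a
  proof -
    define b where "b = (\<lambda>p\<in>P. near (a p))"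
    have b_net: "b \<in> net" using near a by (auto simp: b_def net_def)
    have ab: "cmod (b p - a p) \<le> \<kappa>" if "p \<in> P" for p
      using near[OF a[OF that]] that by (auto simp: b_def dist_norm)
    have g_le: "cmod (g x) \<le> 2 * nrm X x" if "x \<in> carrier X" for x
      using g that unfolding small_on_def by auto
    have g_lin: "linear_functional X g" using g unfolding small_on_def by auto
    have yb: "y b \<in> carrier X" and S: "lincomb X b P \<in> carrier X" using y(1) submodule_subset[OF X Y] P(2) by auto
    have "cmod (\<Sum>p\<in>P. b p * g p) = cmod (g (lincomb X b P))"
      using X.linear_functional_lincomb[OF g_lin P] by simp
    also have "\<dots> = cmod (g (y b \<oplus>\<^bsub>X\<^esub> lincomb X b P) - g (y b))"
      using g_lin yb S unfolding linear_functional_def by simp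
    also have "\<dots> \<le> cmod (g (y b \<oplus>\<^bsub>X\<^esub> lincomb X b P)) + cmod (g (y b))"
      by (rule norm_triangle_ineq4)
    also have "\<dots> \<le> 2 * nrm X (y b \<oplus>\<^bsub>X\<^esub> lincomb X b P) + \<kappa>"
      using g b_net yb S g_le unfolding small_on_def by (intro add_mono) auto
    also have "\<dots> \<le> 2 * ?n b + 3 * \<kappa>" using y(2)[of b] by simp
    also have "?n b \<le> ?n a + \<kappa> * R"
      unfolding R_def by (rule nrm_quotient_lincomb_le[OF X Y P ab])
    finally have gb: "cmod (\<Sum>p\<in>P. b p * g p) \<le> 2 * ?n a + 2 * \<kappa> * R + 3 * \<kappa>" by simp
    have "cmod (\<Sum>p\<in>P. (b p - a p) * g p) \<le> (\<Sum>p\<in>P. \<kappa> * (2 * nrm X p))"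
      using ab g_le P(2) \<kappa>(1) by (intro sum_norm_le) (auto simp: norm_mult intro!: mult_mono)
    also have "\<dots> = 2 * \<kappa> * R" by (simp add: R_def sum_distrib_left mult_ac)
    finally have diff: "cmod (\<Sum>p\<in>P. (b p - a p) * g p) \<le> 2 * \<kappa> * R" .
    have "(\<Sum>p\<in>P. a p * g p) = (\<Sum>p\<in>P. b p * g p) - (\<Sum>p\<in>P. (b p - a p) * g p)"
      by (simp add: sum_subtractf[symmetric] algebra_simps)
    then have "cmod (\<Sum>p\<in>P. a p * g p) \<le> cmod (\<Sum>p\<in>P. b p * g p) + cmod (\<Sum>p\<in>P. (b p - a p) * g p)"
      by (simp add: norm_triangle_ineq4)
    also have "\<dots> \<le> 2 * ?n a + (4 * R * \<kappa> + 3 * \<kappa>)" using gb diff by (simp add: mult_ac)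
    finally show ?thesis unfolding \<kappa>(2) .
  qed
  have "cmod (\<Sum>p\<in>P. a p * g p) \<le> 2 * ?n a + \<sigma> * (\<Sum>p\<in>P. cmod (a p))"
    if g: "g \<in> small_on X (y ` net) \<kappa>" for g a
  proof (cases "(\<Sum>p\<in>P. cmod (a p)) = 0")
    case True
    then have "a p = 0" if "p \<in> P" for p using that P(1) by (simp add: sum_nonneg_eq_0_iff)
    then have "(\<Sum>p\<in>P. a p * g p) = 0" by simp
    then show ?thesis using True nrm_quotient_proj_nonneg[OF X Y, of "lincomb X a P"] P(2) by auto
  next
    case False
    define t where "t = (\<Sum>p\<in>P. cmod (a p))"
    have t: "t > 0" using False sum_nonneg[of P "\<lambda>p. cmod (a p)"] unfolding t_def by simp
    \<comment> \<open>Both sides are homogeneous, so the coefficients may be scaled into the polydisc.\<close>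
    define c where "c = complex_of_real (1 / t)"
    have c: "c \<noteq> 0" "cmod c = 1 / t" using t by (auto simp: c_def norm_divide)
    have "cmod (c * a p) \<le> 1" if "p \<in> P" for p
    proof -
      have "cmod (a p) \<le> t" unfolding t_def using that P(1) by (intro member_le_sum) auto
      then show ?thesis using t by (simp add: norm_mult c(2))
    qed
    then have "cmod (\<Sum>p\<in>P. c * a p * g p) \<le> 2 * ?n (\<lambda>p. c * a p) + \<sigma>"
      using unit[OF g, of "\<lambda>p. c * a p"] by blast
    moreover have "(\<Sum>p\<in>P. c * a p * g p) = c * (\<Sum>p\<in>P. a p * g p)"
      by (simp add: sum_distrib_left mult_ac)
    moreover have "?n (\<lambda>p. c * a p) \<le> cmod c * ?n a"
      unfolding X.lincomb_scale[OF P] using P(2) c(1) by (intro nrm_quotient_proj_smult_le[OF X Y]) auto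
    ultimately have "cmod (\<Sum>p\<in>P. a p * g p) / t \<le> 2 * (?n a / t) + \<sigma>"
      by (simp add: norm_mult c(2))
    then show ?thesis using t unfolding t_def[symmetric] by (simp add: field_simps)
  qed
  moreover have "finite (y ` net)" "y ` net \<subseteq> Y"
    using K(1) P(1) y(1) by (auto simp: net_def intro: finite_PiE)
  ultimately show ?thesis using \<kappa>(1) by blast
qed

text \<open>
  On a block of length \<open>M\<close> the functionals that are small on \<open>Z\<close> behave as functionals on
  \<open>X/Y\<close>, so a factorization for the quotient bounds their number.  One block length serves them all,
  because \<open>Z\<close> and \<open>\<rho>\<close> are chosen after \<open>M\<close>.
\<close>

lemma small_on_Y_sup_coverable:
  fixes X :: "'a normed_space" and E :: "'d normed_space" and \<epsilon> \<theta> :: real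
  assumes X: "complex_normed_space X" and Y: "submodule Y complex_field X"
    and E: "complex_normed_space E" and \<iota>: "isometric_map (quotient_space X Y) E \<iota>"
    and \<alpha>: "isometric_map X X \<alpha>"
    and eq: "\<And>x. x \<in> carrier X \<Longrightarrow> \<alpha>' (quotient_proj X Y x) = quotient_proj X Y (\<alpha> x)"
    and fac: "subexp_factorable (quotient_space X Y) E \<iota> \<alpha>'"
    and \<Omega>: "finite \<Omega>" "\<Omega> \<subseteq> carrier X" and \<epsilon>: "\<epsilon> > 0" and \<theta>: "\<theta> > 0"
  obtains M :: nat and Z \<rho> where "M > 0" "finite Z" "Z \<subseteq> Y" "\<rho> > 0"
    "sup_coverable (small_on X Z \<rho>) (orbit \<alpha> \<Omega> M) \<epsilon> (exp (\<theta> * M))"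
proof -
  interpret X: complex_normed_space X by fact
  let ?Q = "quotient_proj X Y" and ?XY = "quotient_space X Y"
  note \<alpha>_carr = isometric_mapD(1)[OF \<alpha>]
  note Q_lin = linear_map_quotient_proj[OF X Y]
  obtain R :: real where R: "R > 0" and nrm_R: "\<And>n p. p \<in> orbit \<alpha> \<Omega> n \<Longrightarrow> nrm X p \<le> R"
    using bounded_orbits[OF X \<alpha> \<Omega>] by metis
  define c where "c = card \<Omega>"
  have "2 * R > 0" using R by simp
  moreover have "\<theta> / (3 * (c + 1)) > 0" using \<theta> by (intro divide_pos_pos) auto
  ultimately show thesis
  proof (rule sup_coverable_of_dual_bound[OF _ \<epsilon>, where 'a='a])
    fix \<delta> :: real and m :: nat
    assume \<delta>: "\<delta> > 0"
      and core: "\<And>(P :: 'a set) d (A :: nat \<Rightarrow> 'a \<Rightarrow> complex) F.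
        finite P \<Longrightarrow>
        (\<And>k p. k < d \<Longrightarrow> p \<in> P \<Longrightarrow> cmod (A k p) \<le> 2 * R) \<Longrightarrow>
        (\<And>b p. b \<in> F \<Longrightarrow> p \<in> P \<Longrightarrow> cmod (b p) \<le> 2 * R) \<Longrightarrow>
        (\<And>b a. b \<in> F \<Longrightarrow> \<exists>k<d. cmod (\<Sum>p\<in>P. a p * b p)
            \<le> cmod (\<Sum>p\<in>P. a p * A k p) + \<delta> * (\<Sum>p\<in>P. cmod (a p))) \<Longrightarrow>
        sup_coverable F P \<epsilon> ((4 * real d) ^ m * exp (\<theta> / (3 * (c + 1)) * card P))"
    have m: "\<theta> / (3 * (m + 1)) > 0" using \<theta> by (intro divide_pos_pos) auto
    have Q\<Omega>: "finite (?Q ` \<Omega>)" "?Q ` \<Omega> \<subseteq> carrier ?XY"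
      using \<Omega> Q_lin unfolding linear_map_def by auto
    \<comment> \<open>The quotient error counts twice, since \<open>g\<close> has norm at most 2; the other half of \<open>\<delta>\<close> pays for
      \<open>g\<close> not vanishing on \<open>Y\<close>.\<close>
    have \<delta>4: "\<delta> / 4 > 0" using \<delta> by simp
    have "\<forall>\<^sub>F n in sequentially. \<exists>\<phi> \<psi> d. (\<phi>, \<psi>, d) \<in> CA ?XY E \<iota> (orbit \<alpha>' (?Q ` \<Omega>) n) (\<delta> / 4) \<and>
        real d \<le> exp (\<theta> / (3 * (m + 1)) * real n)"
      using fac Q\<Omega> \<delta>4 m unfolding subexp_factorable_def by blast
    with eventually_count_le_exp[OF \<theta>, of m c] eventually_gt_at_top[of 0]
    have "\<forall>\<^sub>F M in sequentially. M > 0 \<and> (\<exists>\<phi> \<psi> d. (\<phi>, \<psi>, d) \<in> CA ?XY E \<iota> (orbit \<alpha>' (?Q ` \<Omega>) M) (\<delta> / 4) \<and>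
        real d \<le> exp (\<theta> / (3 * (m + 1)) * real M)) \<and>
        (\<forall>d k. real d \<le> exp (\<theta> / (3 * (m + 1)) * M) \<longrightarrow> k \<le> M * c \<longrightarrow>
          (4 * real d) ^ m * exp (\<theta> / (3 * (c + 1)) * real k) \<le> exp (\<theta> * M))"
      (is "eventually ?good _")
      by (intro eventually_conj)
    from eventually_happens'[OF sequentially_bot this] obtain M where good: "?good M" by (rule exE)
    from conjunct1[OF good] conjunct1[OF conjunct2[OF good]] conjunct2[OF conjunct2[OF good]]
    have M: "M > 0"
      and ex: "\<exists>\<phi> \<psi> d. (\<phi>, \<psi>, d) \<in> CA ?XY E \<iota> (orbit \<alpha>' (?Q ` \<Omega>) M) (\<delta> / 4) \<and>
        real d \<le> exp (\<theta> / (3 * (m + 1)) * real M)"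
      and count: "\<And>d k. real d \<le> exp (\<theta> / (3 * (m + 1)) * M) \<Longrightarrow> k \<le> M * c \<Longrightarrow>
        (4 * real d) ^ m * exp (\<theta> / (3 * (c + 1)) * real k) \<le> exp (\<theta> * M)"
      by blast+
    define P where "P = orbit \<alpha> \<Omega> M"
    have P: "finite P" "P \<subseteq> carrier X"
      unfolding P_def using \<Omega>(1) orbit_subset[OF \<alpha>_carr \<Omega>(2)] by auto
    have QP: "orbit \<alpha>' (?Q ` \<Omega>) M = ?Q ` P"
      unfolding P_def by (rule orbit_quotient_proj[OF X Y \<alpha>_carr eq \<Omega>(2)])
    obtain \<phi> \<psi> d where CA: "(\<phi>, \<psi>, d) \<in> CA ?XY E \<iota> (?Q ` P) (\<delta> / 4)"
      and d_le: "real d \<le> exp (\<theta> / (3 * (m + 1)) * real M)"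
      using ex unfolding QP by blast
    from CA have d: "d > 0" and \<phi>: "contractive_map ?XY (linf d) \<phi>" and \<psi>: "contractive_map (linf d) E \<psi>"
      and close: "\<And>p. p \<in> P \<Longrightarrow> nrm E (\<psi> (\<phi> (?Q p)) \<ominus>\<^bsub>E\<^esub> \<iota> (?Q p)) < \<delta> / 4"
      by (auto simp: CA_def)
    have \<Phi>: "linear_map X (linf d) (\<lambda>x. \<phi> (?Q x))"
      using \<phi> linear_map_comp[OF Q_lin] unfolding contractive_map_def by blast
    have v: "linear_map X E (\<lambda>x. \<iota> (?Q x))"
      by (rule linear_map_comp[OF Q_lin isometric_mapD(2)[OF \<iota>]])
    have Q_carr: "?Q x \<in> carrier ?XY" if "x \<in> carrier X" for x
      using Q_lin that unfolding linear_map_def by auto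
    have nrm_Q: "nrm ?XY (?Q x) \<le> nrm X x" if "x \<in> carrier X" for x
      using nrm_quotient_proj_le[OF X Y that, of "\<zero>\<^bsub>X\<^esub>"] that Y
      by (simp add: submodule_def additive_subgroup.zero_closed[OF additive_subgroup.intro])
    have "\<delta> / 2 > 0" using \<delta> by simp
    from small_on_Y_almost_annihilates[OF X Y P this]
    obtain Z \<rho> where Z: "finite Z" "Z \<subseteq> Y" "\<rho> > 0"
      and ann: "\<And>g a. g \<in> small_on X Z \<rho> \<Longrightarrow> cmod (\<Sum>p\<in>P. a p * g p)
        \<le> 2 * nrm ?XY (?Q (lincomb X a P)) + \<delta> / 2 * (\<Sum>p\<in>P. cmod (a p))"
      by blast
    have "sup_coverable (small_on X Z \<rho>) P \<epsilon> ((4 * real d) ^ m * exp (\<theta> / (3 * (c + 1)) * card P))"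
    proof (rule core[OF P(1), where A = "\<lambda>k p. 2 * \<phi> (?Q p) k"])
      fix k p assume k: "k < d" and p: "p \<in> P"
      have pX: "p \<in> carrier X" using p P by auto
      have "cmod (\<phi> (?Q p) k) \<le> nrm (linf d) (\<phi> (?Q p))" by (rule coordinate_le_nrm_linf[OF k])
      also have "\<dots> \<le> nrm ?XY (?Q p)"
        using \<phi> Q_carr[OF pX] unfolding contractive_map_def by blast
      also have "\<dots> \<le> R" using nrm_Q[OF pX] nrm_R p unfolding P_def by force
      finally show "cmod (2 * \<phi> (?Q p) k) \<le> 2 * R" by (simp add: norm_mult)
    next
      fix g p assume "g \<in> small_on X Z \<rho>" and p: "p \<in> P"
      then have "cmod (g p) \<le> 2 * nrm X p" using P(2) unfolding small_on_def by auto
      also have "\<dots> \<le> 2 * R" using nrm_R p unfolding P_def by force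
      finally show "cmod (g p) \<le> 2 * R" .
    next
      fix g a assume g: "g \<in> small_on X Z \<rho>"
      obtain k where k: "k < d" "nrm E (\<iota> (?Q (lincomb X a P)))
          \<le> cmod (\<Sum>p\<in>P. a p * \<phi> (?Q p) k) + \<delta> / 4 * (\<Sum>p\<in>P. cmod (a p))"
        using nrm_lincomb_le_coordinate[OF X E d \<Phi> \<psi> v P, of "\<delta> / 4" a] close
        by (meson less_imp_le)
      have "nrm ?XY (?Q (lincomb X a P)) = nrm E (\<iota> (?Q (lincomb X a P)))"
        using isometric_mapD(3)[OF \<iota> Q_carr] P(2) by auto
      then have "cmod (\<Sum>p\<in>P. a p * g p)
          \<le> 2 * cmod (\<Sum>p\<in>P. a p * \<phi> (?Q p) k) + \<delta> * (\<Sum>p\<in>P. cmod (a p))"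
        using ann[OF g, of a] k(2) by linarith
      also have "2 * cmod (\<Sum>p\<in>P. a p * \<phi> (?Q p) k) = cmod (\<Sum>p\<in>P. a p * (2 * \<phi> (?Q p) k))"
      proof -
        have "(\<Sum>p\<in>P. a p * (2 * \<phi> (?Q p) k)) = 2 * (\<Sum>p\<in>P. a p * \<phi> (?Q p) k)"
          by (simp add: sum_distrib_left mult_ac)
        then show ?thesis by (simp add: norm_mult)
      qed
      finally show "\<exists>k<d. cmod (\<Sum>p\<in>P. a p * g p)
          \<le> cmod (\<Sum>p\<in>P. a p * (2 * \<phi> (?Q p) k)) + \<delta> * (\<Sum>p\<in>P. cmod (a p))"
        using k(1) by blast
    qed
    then have "sup_coverable (small_on X Z \<rho>) P \<epsilon> (exp (\<theta> * M))"
    proof (rule sup_coverable_mono)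
      show "(4 * real d) ^ m * exp (\<theta> / (3 * (c + 1)) * card P) \<le> exp (\<theta> * M)"
        using card_orbit_le[OF \<Omega>(1), of \<alpha> M] by (intro count[OF d_le]) (simp add: P_def c_def)
    qed
    then show thesis using M Z unfolding P_def by (intro that)
  qed
qed

text \<open>
  The label of a functional \<open>f\<close> on \<open>X\<close> consists of the label \<open>L f\<close> of its restriction to
  \<open>Y\<close>, and of the labels of \<open>(f - g) \<circ> \<alpha>\<^sup>j\<^sup>M\<close> for all blocks \<open>j\<close>, where
  \<open>g\<close> is a representative of \<open>L f\<close>.  The differences are small on \<open>Z\<close>, since \<open>f\<close> and
  \<open>g\<close> have the same label on the orbit of \<open>Z\<close>.
\<close>

lemma coverable_extension:
  fixes X :: "'a normed_space" and E :: "'d normed_space"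
  assumes X: "complex_normed_space X" and Y: "submodule Y complex_field X"
    and E: "complex_normed_space E" and \<iota>: "isometric_map (quotient_space X Y) E \<iota>"
    and \<alpha>: "isometric_map X X \<alpha>" and \<alpha>Y: "\<alpha> \<in> Y \<rightarrow> Y"
    and eq: "\<And>x. x \<in> carrier X \<Longrightarrow> \<alpha>' (quotient_proj X Y x) = quotient_proj X Y (\<alpha> x)"
    and covY: "subexp_coverable (subspace_of X Y) (restrict \<alpha> Y)"
    and fac: "subexp_factorable (quotient_space X Y) E \<iota> \<alpha>'"
  shows "subexp_coverable X \<alpha>"
  unfolding subexp_coverable_def
proof (intro allI impI)
  fix \<Omega> and \<epsilon> \<theta> :: real
  assume \<Omega>: "finite \<Omega>" "\<Omega> \<subseteq> carrier X" and \<epsilon>: "\<epsilon> > 0" and \<theta>: "\<theta> > 0"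
  interpret X: complex_normed_space X by fact
  have YX: "Y \<subseteq> carrier X" using X.submoduleE(1)[OF Y] .
  have \<theta>4: "\<theta> / 4 > 0" using \<theta> by simp
  obtain M :: nat and Z \<rho> where M: "M > 0" and Z: "finite Z" "Z \<subseteq> Y" and \<rho>: "\<rho> > 0"
    and block: "sup_coverable (small_on X Z \<rho>) (orbit \<alpha> \<Omega> M) \<epsilon> (exp (\<theta> / 4 * M))"
    by (rule small_on_Y_sup_coverable[OF X Y E \<iota> \<alpha> eq fac \<Omega> \<epsilon> \<theta>4]) (assumption, rule that)
  obtain L' :: "('a \<Rightarrow> complex) \<Rightarrow> nat"
    where L': "finite (L' ` small_on X Z \<rho>)" "card (L' ` small_on X Z \<rho>) \<le> exp (\<theta> / 4 * M)"
    and L'_close: "\<And>f g p. f \<in> small_on X Z \<rho> \<Longrightarrow> g \<in> small_on X Z \<rho> \<Longrightarrow> L' f = L' g \<Longrightarrow>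
      p \<in> orbit \<alpha> \<Omega> M \<Longrightarrow> cmod (f p - g p) \<le> \<epsilon>"
    by (rule sup_coverableE[OF block]) (rule that)
  have "Z \<subseteq> carrier (subspace_of X Y)" using Z by simp
  then have "\<forall>\<^sub>F n in sequentially. sup_coverable (dual_ball (subspace_of X Y))
      (orbit (restrict \<alpha> Y) Z n) \<rho> (exp (\<theta> / 4 * real n))"
    using covY Z \<rho> \<theta>4 unfolding subexp_coverable_def by blast
  \<comment> \<open>The last block may begin at time \<open>n\<close>, so \<open>Z\<close> is observed for \<open>n + 1\<close> steps.\<close>
  then have "\<forall>\<^sub>F n in sequentially. sup_coverable (dual_ball (subspace_of X Y))
      (orbit (restrict \<alpha> Y) Z (Suc n)) \<rho> (exp (\<theta> / 4 * real (Suc n)))"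
    by (subst eventually_sequentially_Suc)
  then show "\<forall>\<^sub>F n in sequentially. sup_coverable (dual_ball X) (orbit \<alpha> \<Omega> n) \<epsilon> (exp (\<theta> * real n))"
    using eventually_gt_at_top[of M]
  proof eventually_elim
    case (elim n)
    let ?B = "dual_ball X" and ?G = "small_on X Z \<rho>"
    have covZ: "sup_coverable (dual_ball (subspace_of X Y)) (orbit \<alpha> Z (Suc n)) \<rho> (exp (\<theta> / 4 * real (Suc n)))"
      using elim(1) unfolding orbit_restrict[OF \<alpha>Y Z(2)] .
    obtain L :: "('a \<Rightarrow> complex) \<Rightarrow> nat"
      where L: "finite (L ` dual_ball (subspace_of X Y))"
        "card (L ` dual_ball (subspace_of X Y)) \<le> exp (\<theta> / 4 * Suc n)"
      and L_close: "\<And>f g p. f \<in> dual_ball (subspace_of X Y) \<Longrightarrow> g \<in> dual_ball (subspace_of X Y) \<Longrightarrow>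
        L f = L g \<Longrightarrow> p \<in> orbit \<alpha> Z (Suc n) \<Longrightarrow> cmod (f p - g p) \<le> \<rho>"
      by (rule sup_coverableE[OF covZ]) (rule that)
    have B_sub: "f \<in> dual_ball (subspace_of X Y)" if "f \<in> ?B" for f
      using that YX unfolding dual_ball_def linear_functional_def by (auto simp: subset_iff)
    define rep where "rep l = (SOME g. g \<in> ?B \<and> L g = l)" for l
    have rep: "rep (L f) \<in> ?B \<and> L (rep (L f)) = L f" if "f \<in> ?B" for f
      unfolding rep_def by (rule someI[of _ f]) (use that in simp)
    define D where "D f j = (\<lambda>x. f ((\<alpha> ^^ (j * M)) x) - rep (L f) ((\<alpha> ^^ (j * M)) x))" for f j
    have D: "D f j \<in> ?G" if f: "f \<in> ?B" and j: "j \<le> n div M" for f j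
    proof -
      let ?g = "rep (L f)" and ?\<beta> = "\<alpha> ^^ (j * M)"
      have g: "?g \<in> ?B" "L ?g = L f" using rep[OF f] by auto
      note \<beta> = isometric_funpow[OF \<alpha>, of "j * M"]
      have lin: "linear_functional X (\<lambda>x. h (?\<beta> x))" if "h \<in> ?B" for h
        using that isometric_mapD(1,2)[OF \<beta>]
        unfolding dual_ball_def linear_functional_def linear_map_def by (auto simp: Pi_iff)
      have le: "cmod (h (?\<beta> x)) \<le> nrm X x" if "h \<in> ?B" "x \<in> carrier X" for h x
      proof -
        have "?\<beta> x \<in> carrier X" using isometric_mapD(1)[OF \<beta>] that(2) by auto
        then have "cmod (h (?\<beta> x)) \<le> nrm X (?\<beta> x)" using that(1) unfolding dual_ball_def by auto
        then show ?thesis using isometric_mapD(3)[OF \<beta> that(2)] by simp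
      qed
      have "linear_functional X (D f j)"
        using lin[OF f] lin[OF g(1)] unfolding linear_functional_def D_def by (auto simp: algebra_simps)
      moreover have "cmod (D f j x) \<le> 2 * nrm X x" if "x \<in> carrier X" for x
        using norm_triangle_ineq4[of "f (?\<beta> x)" "?g (?\<beta> x)"] le[OF f that] le[OF g(1) that]
        unfolding D_def by linarith
      moreover have "cmod (D f j y) \<le> \<rho>" if y: "y \<in> Z" for y
      proof -
        have "j * M \<le> n" using mult_le_mono1[OF j, of M] by (meson div_times_less_eq_dividend le_trans)
        then have "?\<beta> y \<in> orbit \<alpha> Z (Suc n)" using y by auto
        then show ?thesis
          using L_close[OF B_sub[OF f] B_sub[OF g(1)]] g(2) unfolding D_def by simp
      qed
      ultimately show ?thesis unfolding small_on_def by auto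
    qed
    define H where "H = L ` dual_ball (subspace_of X Y) \<times> ({..n div M} \<rightarrow>\<^sub>E L' ` ?G)"
    have finH: "finite H" unfolding H_def using L(1) L'(1) by (intro finite_cartesian_product finite_PiE) auto
    have cardH: "real (card H) \<le> exp (\<theta> * n)"
    proof -
      have "real (card H) = card (L ` dual_ball (subspace_of X Y)) * real (card (L' ` ?G)) ^ Suc (n div M)"
        unfolding H_def card_cartesian_product by (subst card_PiE) auto
      also have "\<dots> \<le> exp (\<theta> / 4 * Suc n) * exp (\<theta> / 4 * M) ^ Suc (n div M)"
        using L(2) L'(2) by (intro mult_mono power_mono) auto
      also have "\<dots> = exp (\<theta> / 4 * Suc n + Suc (n div M) * (\<theta> / 4 * M))"
        by (simp only: exp_add exp_of_nat_mult)
      also have "\<dots> \<le> exp (\<theta> * n)"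
      proof -
        have "real (n div M * M) \<le> real n" by (subst of_nat_le_iff) simp
        then have "1 + real n + (real (n div M) + 1) * real M \<le> 4 * real n"
          using elim(2) M by (simp add: algebra_simps)
        then have "\<theta> / 4 * (1 + real n + (real (n div M) + 1) * real M) \<le> \<theta> / 4 * (4 * real n)"
          using \<theta>4 by (intro mult_left_mono) auto
        then show ?thesis by (simp add: algebra_simps add_divide_distrib)
      qed
      finally show ?thesis .
    qed
    show ?case
    proof (rule sup_coverableI[OF finH _ cardH, where L = "\<lambda>f. (L f, \<lambda>j\<in>{..n div M}. L' (D f j))"])
      show "(L f, \<lambda>j\<in>{..n div M}. L' (D f j)) \<in> H" if "f \<in> ?B" for f
        using that B_sub D unfolding H_def by auto
      fix f g p
      assume f: "f \<in> ?B" and g: "g \<in> ?B" and p: "p \<in> orbit \<alpha> \<Omega> n"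
        and same: "(L f, \<lambda>j\<in>{..n div M}. L' (D f j)) = (L g, \<lambda>j\<in>{..n div M}. L' (D g j))"
      obtain k x where k: "k < n" and x: "x \<in> \<Omega>" and px: "p = (\<alpha> ^^ k) x" using p by auto
      define j r where "j = k div M" and "r = k mod M"
      have j: "j \<le> n div M" unfolding j_def using k by (intro div_le_mono) simp
      have "r < M" using M by (simp add: r_def)
      then have q: "(\<alpha> ^^ r) x \<in> orbit \<alpha> \<Omega> M" using x by auto
      have "k = j * M + r" by (simp add: j_def r_def)
      then have p_eq: "p = (\<alpha> ^^ (j * M)) ((\<alpha> ^^ r) x)" by (simp add: px funpow_add)
      have Lfg: "L f = L g" using same by simp
      have "(\<lambda>j\<in>{..n div M}. L' (D f j)) j = (\<lambda>j\<in>{..n div M}. L' (D g j)) j" using same by simp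
      then have "L' (D f j) = L' (D g j)" using j by simp
      then have "cmod (D f j ((\<alpha> ^^ r) x) - D g j ((\<alpha> ^^ r) x)) \<le> \<epsilon>"
        by (intro L'_close[OF D[OF f j] D[OF g j] _ q])
      then show "cmod (f p - g p) \<le> \<epsilon>" by (simp add: D_def Lfg p_eq)
    qed
  qed
qed


section \<open>Vanishing entropy of a system and of its subspace and quotient\<close>

theorem lemma6p2:
  fixes X :: "'a normed_space" and Y :: "'a set"
    and \<alpha> :: "'a \<Rightarrow> 'a" and \<alpha>' :: "'a set \<Rightarrow> 'a set"
    and E :: "'b normed_space" and \<iota> :: "'a \<Rightarrow> 'b"
    and E\<^sub>Y :: "'c normed_space" and \<iota>\<^sub>Y :: "'a \<Rightarrow> 'c"
    and E\<^sub>Q :: "'d normed_space" and \<iota>\<^sub>Q :: "'a set \<Rightarrow> 'd"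
  assumes "banach_space X" and "closed_subspace Y X"
    and "isometric_automorphism X \<alpha>" and "\<alpha> ` Y = Y"
    and "isometric_automorphism (quotient_space X Y) \<alpha>'"
    and "\<And>x. x \<in> carrier X \<Longrightarrow> \<alpha>' (quotient_proj X Y x) = quotient_proj X Y (\<alpha> x)"
    and "CA_embedding X E \<iota>"
    and "CA_embedding (subspace_of X Y) E\<^sub>Y \<iota>\<^sub>Y"
    and "CA_embedding (quotient_space X Y) E\<^sub>Q \<iota>\<^sub>Q"
  shows "hc X E \<iota> \<alpha> = 0 \<longleftrightarrow>
    hc (subspace_of X Y) E\<^sub>Y \<iota>\<^sub>Y (restrict \<alpha> Y) = 0 \<and>
    hc (quotient_space X Y) E\<^sub>Q \<iota>\<^sub>Q \<alpha>' = 0"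
proof -
  have X: "complex_normed_space X" using assms(1) by (simp add: banach_space_def)
  interpret X: complex_normed_space X by fact
  have Y: "submodule Y complex_field X" using assms(2) by (simp add: closed_subspace_def)
  have YX: "Y \<subseteq> carrier X" using X.submoduleE(1)[OF Y] .
  have \<alpha>: "isometric_map X X \<alpha>" using assms(3) by (simp add: isometric_automorphism_def)
  note \<alpha>_carr = isometric_mapD(1)[OF \<alpha>]
  have \<alpha>Y: "\<alpha> \<in> Y \<rightarrow> Y" using assms(4) by auto
  have \<alpha>Y_carr: "restrict \<alpha> Y \<in> carrier (subspace_of X Y) \<rightarrow> carrier (subspace_of X Y)"
    using \<alpha>Y by auto
  have \<alpha>Y_iso: "isometric_map (subspace_of X Y) (subspace_of X Y) (restrict \<alpha> Y)"
    using \<alpha> \<alpha>Y YX X.submoduleE(4,5)[OF Y]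
    unfolding isometric_map_def linear_map_def by (auto simp: subset_iff)
  have \<alpha>'_carr: "\<alpha>' \<in> carrier (quotient_space X Y) \<rightarrow> carrier (quotient_space X Y)"
    using assms(5) isometric_mapD(1) unfolding isometric_automorphism_def by blast
  have emb: "complex_normed_space F" "isometric_map V F j" if "CA_embedding V F j"
    for V :: "'e normed_space" and F :: "'f normed_space" and j
    using that by (auto simp: CA_embedding_def banach_space_def)
  note XY = complex_normed_space_subspace[OF X Y]
  note E = emb[OF assms(7)] and EY = emb[OF assms(8)] and EQ = emb[OF assms(9)]
  have hcX: "hc X E \<iota> \<alpha> = 0 \<longleftrightarrow> subexp_factorable X E \<iota> \<alpha>"
    by (rule hc_eq_0_iff_factorable[OF assms(7) \<alpha>_carr])
  have hcY: "hc (subspace_of X Y) E\<^sub>Y \<iota>\<^sub>Y (restrict \<alpha> Y) = 0 \<longleftrightarrow>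
      subexp_factorable (subspace_of X Y) E\<^sub>Y \<iota>\<^sub>Y (restrict \<alpha> Y)"
    by (rule hc_eq_0_iff_factorable[OF assms(8) \<alpha>Y_carr])
  have hcQ: "hc (quotient_space X Y) E\<^sub>Q \<iota>\<^sub>Q \<alpha>' = 0 \<longleftrightarrow>
      subexp_factorable (quotient_space X Y) E\<^sub>Q \<iota>\<^sub>Q \<alpha>'"
    by (rule hc_eq_0_iff_factorable[OF assms(9) \<alpha>'_carr])
  show ?thesis
    unfolding hcX hcY hcQ
  proof (intro iffI conjI; (elim conjE)?)
    assume fac: "subexp_factorable X E \<iota> \<alpha>"
    have "subexp_factorable (subspace_of X Y) E \<iota> (restrict \<alpha> Y)"
      by (rule factorable_subspace[OF YX \<alpha>Y fac])
    then have "subexp_coverable (subspace_of X Y) (restrict \<alpha> Y)"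
      by (rule factorable_imp_coverable[OF XY E(1) isometric_map_restrict_domain[OF E(2) YX] \<alpha>Y_iso])
    then show "subexp_factorable (subspace_of X Y) E\<^sub>Y \<iota>\<^sub>Y (restrict \<alpha> Y)"
      by (rule coverable_imp_factorable[OF assms(8) \<alpha>Y_carr])
    have covX: "subexp_coverable X \<alpha>"
      by (rule factorable_imp_coverable[OF X E \<alpha> fac])
    have "subexp_coverable (quotient_space X Y) \<alpha>'"
      by (rule coverable_quotient[OF X Y \<alpha>_carr assms(6) covX])
    then show "subexp_factorable (quotient_space X Y) E\<^sub>Q \<iota>\<^sub>Q \<alpha>'"
      by (rule coverable_imp_factorable[OF assms(9) \<alpha>'_carr])
  next
    assume facY: "subexp_factorable (subspace_of X Y) E\<^sub>Y \<iota>\<^sub>Y (restrict \<alpha> Y)"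
      and facQ: "subexp_factorable (quotient_space X Y) E\<^sub>Q \<iota>\<^sub>Q \<alpha>'"
    have covY: "subexp_coverable (subspace_of X Y) (restrict \<alpha> Y)"
      by (rule factorable_imp_coverable[OF XY EY \<alpha>Y_iso facY])
    have "subexp_coverable X \<alpha>"
      by (rule coverable_extension[OF X Y EQ \<alpha> \<alpha>Y assms(6) covY facQ])
    then show "subexp_factorable X E \<iota> \<alpha>"
      by (rule coverable_imp_factorable[OF assms(7) \<alpha>_carr])
  qed
qed

end
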